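(* Consider the complex compound MISO broadcast channel with $K=2$ users, $M=2$ antennas at the transmitter, and $J_1=J_2=3$ generic channel states for each user. Then, almost surely (with respect to the draw of the channel states), the exact total number of degrees of freedom is $d=\frac{4}{3}$.
   Context: Complex compound MISO broadcast channel. A transmitter with $M>1$ antennas communicates with $K$ single-antenna receivers. For each user $k\in\{1,\dots,K\}$ there is a finite set of $J_k$ possible channel vectors (states) $\mathbf{h}^{[k]}_{1},\dots,\mathbf{h}^{[k]}_{J_k}\in\mathbb{C}^{1\times M}$. If user $k$ is in state $j_k\in\{1,\dots,J_k\}$, its received signal at time $t$ is $$y^{[k]}_{j_k}(t)=\mathbf{h}^{[k]}_{j_k}\mathbf{x}(t)+z^{[k]}_{j_k}(t),$$ where $\mathbf{x}(t)\in\mathbb{C}^{M\times 1}$ is the transmitted vector, subject to the average power constraint $E(\|\mathbf{x}\|^2)\le P$ (averaged over the codeword), and the noise $z^{[k]}_{j_k}(t)$ is i.i.d. zero-mean unit-variance circularly symmetric complex Gaussian. The state of each user is fixed throughout the duration of communication. The sets of possible states are known to all nodes and do not depend on $P$; the transmitter does not know which states are realized, while the receivers have perfect channel knowledge. Generic states / almost surely. All the coefficients of all possible states are drawn from a continuous distribution (absolutely continuous with respect to Lebesgue measure), and "almost surely" refers to this draw. Achievable rates. The transmitter sends independent messages $W^{[k]}$ of rate $R^{[k]}$ to receiver $k$, $k=1,\dots,K$. A rate tuple $(R^{[1]},\dots,R^{[K]})$ is achievable at power $P$ if there are codes (encoder not depending on the realized states) of growing block length such that every receiver $k$ decodes $W^{[k]}$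 with arbitrarily small error probability, regardless of which state is realized. Degrees of freedom. The total number of degrees of freedom is $$d=\lim_{P\to\infty}\frac{C_\Sigma(P)}{\log P},$$ where $C_\Sigma(P)$ is the supremum of $R^{[1]}+\cdots+R^{[K]}$ over all rate tuples achievable at power $P$. *)

theory Defs
  imports "HOL-Probability.Probability"
begin

text \<open>
  Compound MISO broadcast channel: users are indexed by \<open>'k\<close>, the states of each user by \<open>'j\<close>
  (the same number for every user) and the transmit antennas by \<open>'m\<close>. The vector \<open>H $ k $ j\<close> is the
  row vector of channel coefficients of user \<open>k\<close> in state \<open>j\<close>.
\<close>

type_synonym ('m, 'j, 'k) channel_states = "complex ^ 'm ^ 'j ^ 'k"

text \<open>
  The law of a circularly symmetric complex Gaussian \<open>Z\<close> with mean 0 and \<open>E |Z|\<^sup>2 = 1\<close>, i.e. real and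
  imaginary parts are independent, each with variance \<open>1/2\<close>.
\<close>

definition complex_gaussian :: "complex measure" where
  "complex_gaussian =
     density lborel (\<lambda>z. ennreal (exp (- (cmod z)\<^sup>2) / pi))"

definition noise :: "nat \<Rightarrow> (nat \<Rightarrow> complex) measure" where
  "noise n = PiM {..<n} (\<lambda>_. complex_gaussian)"

text \<open>The product of the row \<open>h\<close> with the column \<open>x t\<close> is bilinear: no conjugation is involved.\<close>

definition received ::
  "nat \<Rightarrow> complex ^ 'm::finite \<Rightarrow> (nat \<Rightarrow> complex ^ 'm) \<Rightarrow> (nat \<Rightarrow> complex) \<Rightarrow> nat \<Rightarrow> complex" where
  "received n h x z = (\<lambda>t\<in>{..<n}. (\<Sum>i\<in>UNIV. h $ i * x t $ i) + z t)"

text \<open>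
  Message tuples for block length \<open>n\<close> and rates \<open>R\<close> in bits per channel use. The messages are
  independent and uniform, i.e. the tuple is uniform on this finite set.
\<close>

definition messages :: "nat \<Rightarrow> ('k::finite \<Rightarrow> real) \<Rightarrow> ('k \<Rightarrow> nat) set" where
  "messages n R = (\<Pi>\<^sub>E k\<in>UNIV. {..<nat \<lceil>2 powr (real n * R k)\<rceil>})"

definition average_power ::
  "nat \<Rightarrow> ('k::finite \<Rightarrow> real) \<Rightarrow> (('k \<Rightarrow> nat) \<Rightarrow> nat \<Rightarrow> complex ^ 'm::finite) \<Rightarrow> real" where
  "average_power n R enc =
     (\<Sum>w\<in>messages n R. (\<Sum>t<n. (norm (enc w t))\<^sup>2) / real n) / real (card (messages n R))"

text \<open>
  The tuple \<open>s\<close> is the realized state of each user. Receivers have perfect channel knowledge, hence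
  the decoders may depend on \<open>s\<close>; the encoder does not.
\<close>

definition error_probability ::
  "('m::finite, 'j::finite, 'k::finite) channel_states \<Rightarrow> nat \<Rightarrow> ('k \<Rightarrow> real) \<Rightarrow>
   (('k \<Rightarrow> nat) \<Rightarrow> nat \<Rightarrow> complex ^ 'm) \<Rightarrow>
   (('k \<Rightarrow> 'j) \<Rightarrow> 'k \<Rightarrow> (nat \<Rightarrow> complex) \<Rightarrow> nat) \<Rightarrow> ('k \<Rightarrow> 'j) \<Rightarrow> 'k \<Rightarrow> real" where
  "error_probability H n R enc dec s k =
     (\<Sum>w\<in>messages n R.
        measure (noise n)
          {z \<in> space (noise n). dec s k (received n (H $ k $ s k) (enc w) z) \<noteq> w k})
     / real (card (messages n R))"

text \<open>
  Decoders are required to be measurable, since \<open>measure\<close> is 0 on non-measurable sets and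
  the error event has to be an event.
\<close>

definition achievable ::
  "('m::finite, 'j::finite, 'k::finite) channel_states \<Rightarrow> real \<Rightarrow> ('k \<Rightarrow> real) \<Rightarrow> bool" where
  "achievable H P R \<longleftrightarrow>
     (\<forall>k. 0 \<le> R k) \<and>
     (\<forall>\<epsilon>>0. \<forall>\<^sub>F n in sequentially.
        \<exists>(enc :: ('k \<Rightarrow> nat) \<Rightarrow> nat \<Rightarrow> complex ^ 'm)
         (dec :: ('k \<Rightarrow> 'j) \<Rightarrow> 'k \<Rightarrow> (nat \<Rightarrow> complex) \<Rightarrow> nat).
          (\<forall>s k. dec s k \<in> PiM {..<n} (\<lambda>_. borel) \<rightarrow>\<^sub>M count_space UNIV) \<and>
          average_power n R enc \<le> P \<and>
          (\<forall>s k. error_probability H n R enc dec s k \<le> \<epsilon>))"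

text \<open>The supremum is taken in the extended reals, so it is meaningful without a boundedness proof.\<close>

definition sum_capacity ::
  "('m::finite, 'j::finite, 'k::finite) channel_states \<Rightarrow> real \<Rightarrow> ereal" where
  "sum_capacity H P = (SUP R \<in> {R. achievable H P R}. ereal (\<Sum>k\<in>UNIV. R k))"

definition has_dof ::
  "('m::finite, 'j::finite, 'k::finite) channel_states \<Rightarrow> real \<Rightarrow> bool" where
  "has_dof H d \<longleftrightarrow>
     ((\<lambda>P. sum_capacity H P / ereal (log 2 P)) \<longlongrightarrow> ereal d) at_top"

text \<open>
  Sanity check of the normalization: the complex Gaussian above is the product of two real
  Gaussians of variance \<open>1/2\<close>.
\<close>

lemma complex_gaussian_density_eq:
  "exp (- (cmod z)\<^sup>2) / pi =
     normal_density 0 (sqrt (1/2)) (Re z) * normal_density 0 (sqrt (1/2)) (Im z)"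
  by (simp add: normal_density_def cmod_power2 real_sqrt_divide exp_add[symmetric] exp_minus field_simps)

end

theory Submission
  imports Defs
begin

text \<open>
  Upper bound: the signals \<open>u1\<close>, \<open>u2\<close> of user 1 in two of its states determine the transmitted
  vector, hence also the signal of user 2. For a message \<open>w\<close> of user 1 let \<open>A1 w\<close>, \<open>A2 w\<close> be its
  decoding regions in these states. The codewords for the messages of user 2 are separated inside
  \<open>A1 w \<times> A2 w\<close>, so this set has measure at least about \<open>2 powr (n R\<^sub>2) / P ^ (2 n)\<close> with respect
  to a Gaussian measure of variance \<open>P\<close>, whereas the regions for different \<open>w\<close> are disjoint. The
  inequality of the arithmetic and geometric mean yields \<open>2 R\<^sub>1 + R\<^sub>2 \<le> 2 log P + O(1)\<close>; adding the
  bound with the users exchanged gives \<open>R\<^sub>1 + R\<^sub>2 \<le> 4/3 log P + O(1)\<close>.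

  Achievability: in three channel uses each user is sent four real symbols, two along each of two
  beams. The beams are chosen such that the four interfering symbols fall into a single real plane
  of \<open>\<complex>\<^sup>3\<close> in all three states of the other user, while the desired symbols span a complex plane
  because the ratio of the two beam gains is not real for generic states. After removing the
  interference the symbols, taken from an equidistant grid of about \<open>sqrt P\<close> points, are detected
  correctly up to a small probability, and an outer Gilbert-Varshamov code corrects the
  remaining errors.
\<close>

section \<open>Generic channel states\<close>

text \<open>On each line through \<open>x0\<close> the function is a nonzero univariate polynomial,
  so it has finitely many zeros there. By Tonelli's theorem some scale \<open>s\<close> makes the
  set of \<open>x\<close> with \<open>f (x0 + s *\<^sub>R x) = 0\<close> null, and an affine change
  of variables carries this back to the zero set itself.\<close>

lemma null_sets_zeros_real_polynomial_function:
  fixes f :: "'a::euclidean_space \<Rightarrow> real"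
  assumes f: "real_polynomial_function f" and x0: "f x0 \<noteq> 0"
  shows "{x. f x = 0} \<in> null_sets lborel"
proof -
  have cont: "continuous_on UNIV f"
    using f continuous_on_polymonial_function real_polynomial_function_eq by blast
  have [measurable]: "f \<in> borel_measurable borel"
    using cont by (rule borel_measurable_continuous_onI)
  have line: "finite {s. f (x0 + s *\<^sub>R v) = 0}" for v
  proof -
    have "polynomial_function (\<lambda>s::real. x0 + s *\<^sub>R v)"
      by (intro polynomial_function_add polynomial_function_const polynomial_function_bounded_linear
          bounded_linear_scaleR_left)
    then have "real_polynomial_function (f \<circ> (\<lambda>s. x0 + s *\<^sub>R v))"
      using f by (rule real_polynomial_function_compose)
    then obtain a n where a: "f \<circ> (\<lambda>s. x0 + s *\<^sub>R v) = (\<lambda>s. \<Sum>i\<le>n. a i * s ^ i)"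
      using real_polynomial_function_imp_sum by blast
    have eq: "f (x0 + s *\<^sub>R v) = (\<Sum>i\<le>n. a i * s ^ i)" for s
      using fun_cong[OF a, of s] by simp
    have "\<exists>i\<le>n. a i \<noteq> 0"
    proof (rule ccontr)
      assume "\<not> ?thesis"
      then have "f (x0 + 0 *\<^sub>R v) = 0" unfolding eq by simp
      with x0 show False by simp
    qed
    then show ?thesis unfolding eq using polyfun_finite_roots by blast
  qed
  define g :: "real \<Rightarrow> 'a \<Rightarrow> ennreal"
    where "g s x = indicator {0<..<1} s * indicator {x. f x = 0} (x0 + s *\<^sub>R x)" for s x
  have [measurable]: "case_prod g \<in> borel_measurable (lborel \<Otimes>\<^sub>M lborel)"
    unfolding g_def by measurable
  have "(\<integral>\<^sup>+s. g s x \<partial>lborel) = 0" for x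
  proof -
    have "AE s in lborel. s \<notin> {s. f (x0 + s *\<^sub>R x) = 0}"
      by (intro AE_not_in finite_imp_null_set_lborel line)
    then have "AE s in lborel. g s x = 0"
      by eventually_elim (simp add: g_def indicator_def)
    then show ?thesis by (subst nn_integral_0_iff_AE) auto
  qed
  then have "(\<integral>\<^sup>+s. (\<integral>\<^sup>+x. g s x \<partial>lborel) \<partial>lborel) = 0"
    by (subst lborel_pair.Fubini') auto
  then have "AE s in lborel. (\<integral>\<^sup>+x. g s x \<partial>lborel) = 0"
    by (subst (asm) nn_integral_0_iff_AE) auto
  moreover have "\<not> (AE s in lborel. s \<notin> {0<..<1::real})"
    by (subst AE_iff_measurable[of "{0<..<1}"]) auto
  ultimately have "\<exists>s\<in>{0<..<1}. (\<integral>\<^sup>+x. g s x \<partial>lborel) = 0"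
    by (meson eventually_mono)
  then obtain s where s: "0 < s" "s < 1" "(\<integral>\<^sup>+x. g s x \<partial>lborel) = 0" by auto
  have "emeasure lborel {x. f x = 0}
      = emeasure (density (distr lborel borel (\<lambda>x. x0 + s *\<^sub>R x)) (\<lambda>_. \<bar>s\<bar>^DIM('a))) {x. f x = 0}"
    using s(1) by (intro arg_cong[where f = "\<lambda>M. emeasure M {x. f x = 0}"] lborel_affine) simp
  also have "\<dots> = ennreal (\<bar>s\<bar>^DIM('a)) * (\<integral>\<^sup>+x. g s x \<partial>lborel)"
    using s(1,2) by (simp add: emeasure_density nn_integral_distr nn_integral_cmult g_def del: nn_integral_indicator)
  finally show ?thesis using s by (intro null_setsI) auto
qed

text \<open>Polynomials in the real and imaginary parts of the coefficients: conjugation stays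
  inside this class.\<close>

definition complex_polynomial_function :: "('a::real_normed_vector \<Rightarrow> complex) \<Rightarrow> bool" where
  "complex_polynomial_function f \<longleftrightarrow>
     real_polynomial_function (\<lambda>x. Re (f x)) \<and> real_polynomial_function (\<lambda>x. Im (f x))"

lemma complex_polynomial_function_intros:
  "bounded_linear f \<Longrightarrow> complex_polynomial_function f"
  "complex_polynomial_function f \<Longrightarrow> complex_polynomial_function g \<Longrightarrow>
    complex_polynomial_function (\<lambda>x. f x * g x)"
  "complex_polynomial_function f \<Longrightarrow> complex_polynomial_function g \<Longrightarrow>
    complex_polynomial_function (\<lambda>x. f x - g x)"
  "complex_polynomial_function f \<Longrightarrow> complex_polynomial_function (\<lambda>x. cnj (f x))"
  by (auto simp: complex_polynomial_function_def
      intro!: bounded_linear_compose[OF bounded_linear_Re]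
        bounded_linear_compose[OF bounded_linear_Im])

definition det2 :: "complex ^ 2 \<Rightarrow> complex ^ 2 \<Rightarrow> complex" where
  "det2 x y = x $ 1 * y $ 2 - x $ 2 * y $ 1"

text \<open>This is the imaginary part of \<open>gain2 * cnj gain1\<close> for the beams built from
  user \<open>k\<close>, as seen by user \<open>k'\<close> in state \<open>i\<close>: the ratio of
  the two gains is not real. In particular all determinants involved are nonzero, so
  \<open>H $ k $ 1\<close> and \<open>H $ k $ 3\<close> are linearly independent, which the upper
  bound uses.\<close>

definition generic_states :: "(2, 3, 2) channel_states \<Rightarrow> bool" where
  "generic_states H \<longleftrightarrow> (\<forall>k k' i. k \<noteq> k' \<longrightarrow>
     Im (det2 (H $ k $ 3) (H $ k $ 2) * det2 (H $ k' $ i) (H $ k $ 1) *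
         cnj (det2 (H $ k $ 3) (H $ k $ 1) * det2 (H $ k' $ i) (H $ k $ 2))) \<noteq> 0)"

lemma AE_generic_states: "AE H in lborel. generic_states H"
proof -
  have "AE H in lborel. Im (det2 (H $ k $ 3) (H $ k $ 2) * det2 (H $ k' $ i) (H $ k $ 1) *
      cnj (det2 (H $ k $ 3) (H $ k $ 1) * det2 (H $ k' $ i) (H $ k $ 2))) \<noteq> 0"
    (is "AE H in _. ?F H \<noteq> 0") if "k \<noteq> k'" for k k' :: 2 and i :: 3
  proof -
    have lin: "bounded_linear (\<lambda>H :: (2, 3, 2) channel_states. H $ a $ b $ c)" for a b c
      by (intro bounded_linear_vec_nth bounded_linear_compose[OF bounded_linear_vec_nth])
    have "complex_polynomial_function (\<lambda>H :: (2, 3, 2) channel_states.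
      (det2 (H $ k $ 3) (H $ k $ 2) * det2 (H $ k' $ i) (H $ k $ 1) *
      cnj (det2 (H $ k $ 3) (H $ k $ 1) * det2 (H $ k' $ i) (H $ k $ 2))))"
      unfolding det2_def by (intro complex_polynomial_function_intros lin)
    then have poly: "real_polynomial_function ?F"
      by (simp add: complex_polynomial_function_def)
    \<comment> \<open>User \<open>k\<close> gets the states (1, 0), (0, 1), (1, 1) and the other
      user always (1, \<open>\<i>\<close>); the product inside \<open>Im\<close> is then
      \<open>\<i>\<close>.\<close>
    define H0 :: "(2, 3, 2) channel_states" where
      "H0 = (\<chi> a b c. if a = k
          then (if b = 1 then (if c = 1 then 1 else 0) else if b = 2 then (if c = 1 then 0 else 1) else 1)
          else (if c = 1 then 1 else \<i>))"
    have "?F H0 \<noteq> 0"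
      using that by (simp add: det2_def H0_def)
    from null_sets_zeros_real_polynomial_function[OF poly this]
    have "AE H in lborel. H \<notin> {H. ?F H = 0}" by (rule AE_not_in)
    then show ?thesis by simp
  qed
  then show ?thesis
    unfolding generic_states_def by (simp add: AE_all_countable)
qed

section \<open>Gaussian vectors\<close>

text \<open>\<open>v\<close> is the total variance; the real and imaginary parts have variance
  \<open>v / 2\<close> each.\<close>

definition cgauss :: "real \<Rightarrow> complex \<Rightarrow> complex \<Rightarrow> real" where
  "cgauss v m z = exp (- (cmod (z - m))\<^sup>2 / v) / (pi * v)"

lemma cgauss_nonneg: "0 < v \<Longrightarrow> 0 \<le> cgauss v m z"
  by (simp add: cgauss_def)

lemma measurable_cgauss [measurable]:
  assumes [measurable]: "f \<in> borel_measurable M" "g \<in> borel_measurable M"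
  shows "(\<lambda>x. cgauss v (f x) (g x)) \<in> borel_measurable M"
  unfolding cgauss_def by measurable

lemma nn_integral_cgauss:
  assumes "0 < v"
  shows "(\<integral>\<^sup>+z. ennreal (cgauss v m z) \<partial>lborel) = 1"
proof -
  have one: "(\<integral>\<^sup>+x. ennreal (normal_density \<mu> (sqrt (v / 2)) x) \<partial>lborel) = 1" for \<mu>
  proof -
    interpret prob_space "density lborel (normal_density \<mu> (sqrt (v / 2)))"
      using assms by (intro prob_space_normal_density) simp
    show ?thesis
      using emeasure_space_1 by (simp add: emeasure_density)
  qed
  define f where "f b = (\<lambda>x. ennreal (normal_density (m \<bullet> b) (sqrt (v / 2)) x))" for b
  have "ennreal (cgauss v m z) = (\<Prod>b\<in>Basis. f b (z \<bullet> b))" for z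
    using assms
    by (simp add: f_def Basis_complex_def cgauss_def normal_density_def cmod_power2
      real_sqrt_divide ennreal_mult[symmetric] exp_add[symmetric] field_simps)
  then have "(\<integral>\<^sup>+z. ennreal (cgauss v m z) \<partial>lborel) = (\<Prod>b\<in>Basis. \<integral>\<^sup>+x. f b x \<partial>lborel)"
    using nn_integral_lborel_prod[of f] by (simp add: f_def)
  then show ?thesis
    by (simp add: f_def one)
qed

lemma prob_space_cgauss: "0 < v \<Longrightarrow> prob_space (density lborel (\<lambda>z. ennreal (cgauss v m z)))"
  by (intro prob_spaceI) (simp add: emeasure_density nn_integral_cgauss)

lemma complex_gaussian_eq: "complex_gaussian = density lborel (\<lambda>z. ennreal (cgauss 1 0 z))"
  by (simp add: complex_gaussian_def cgauss_def)

text \<open>A product measure is determined by its values on boxes, and there the integral of the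
  product density splits into one factor per coordinate.\<close>

lemma (in product_sigma_finite) PiM_density:
  assumes I: "finite I" and f[measurable]: "\<And>i. f i \<in> borel_measurable (M i)"
    and sf: "\<And>i. sigma_finite_measure (density (M i) (f i))"
  shows "PiM I (\<lambda>i. density (M i) (f i)) = density (PiM I M) (\<lambda>x. \<Prod>i\<in>I. f i (x i))"
proof (rule sym, rule product_sigma_finite.PiM_eqI)
  show "product_sigma_finite (\<lambda>i. density (M i) (f i))"
    using sf by (simp add: product_sigma_finite_def)
  show "sets (density (PiM I M) (\<lambda>x. \<Prod>i\<in>I. f i (x i))) = sets (PiM I (\<lambda>i. density (M i) (f i)))"
    by (simp cong: sets_PiM_cong)
  fix A assume "\<And>i. i \<in> I \<Longrightarrow> A i \<in> sets (density (M i) (f i))"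
  then have A[measurable]: "\<And>i. i \<in> I \<Longrightarrow> A i \<in> sets (M i)" by simp
  have [measurable]: "(\<lambda>x. \<Prod>i\<in>I. f i (x i)) \<in> borel_measurable (PiM I M)"
    by (intro borel_measurable_prod_ennreal) measurable
  have "emeasure (density (PiM I M) (\<lambda>x. \<Prod>i\<in>I. f i (x i))) (Pi\<^sub>E I A)
      = (\<integral>\<^sup>+x. (\<Prod>i\<in>I. f i (x i)) * indicator (Pi\<^sub>E I A) x \<partial>PiM I M)"
    using I by (subst emeasure_density) (auto intro!: sets_PiM_I_finite)
  also have "\<dots> = (\<integral>\<^sup>+x. (\<Prod>i\<in>I. f i (x i) * indicator (A i) (x i)) \<partial>PiM I M)"
  proof (rule nn_integral_cong)
    fix x assume x: "x \<in> space (PiM I M)"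
    have "indicator (Pi\<^sub>E I A) x = (\<Prod>i\<in>I. indicator (A i) (x i) :: ennreal)"
      using x I by (auto simp: indicator_def space_PiM PiE_iff prod_eq_1_iff intro!: prod_zero)
    then show "(\<Prod>i\<in>I. f i (x i)) * indicator (Pi\<^sub>E I A) x = (\<Prod>i\<in>I. f i (x i) * indicator (A i) (x i))"
      by (simp add: prod.distrib)
  qed
  also have "\<dots> = (\<Prod>i\<in>I. \<integral>\<^sup>+x. f i x * indicator (A i) x \<partial>M i)"
    using I by (intro product_nn_integral_prod) auto
  also have "\<dots> = (\<Prod>i\<in>I. emeasure (density (M i) (f i)) (A i))"
    by (intro prod.cong refl) (simp add: emeasure_density)
  finally show "emeasure (density (PiM I M) (\<lambda>x. \<Prod>i\<in>I. f i (x i))) (Pi\<^sub>E I A)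
      = (\<Prod>i\<in>I. emeasure (density (M i) (f i)) (A i))" .
qed (use I in auto)

section \<open>Vectors of independent complex Gaussians\<close>

abbreviation lborels :: "nat \<Rightarrow> (nat \<Rightarrow> complex) measure" where
  "lborels n \<equiv> PiM {..<n} (\<lambda>_. lborel)"

definition cgauss_vec :: "nat \<Rightarrow> real \<Rightarrow> (nat \<Rightarrow> complex) \<Rightarrow> (nat \<Rightarrow> complex) measure" where
  "cgauss_vec n v m = PiM {..<n} (\<lambda>t. density lborel (\<lambda>z. ennreal (cgauss v (m t) z)))"

definition cgauss_vec_density :: "nat \<Rightarrow> real \<Rightarrow> (nat \<Rightarrow> complex) \<Rightarrow> (nat \<Rightarrow> complex) \<Rightarrow> real" where
  "cgauss_vec_density n v m y = (\<Prod>t<n. cgauss v (m t) (y t))"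

lemma cgauss_vec_density_nonneg: "0 < v \<Longrightarrow> 0 \<le> cgauss_vec_density n v m y"
  by (simp add: cgauss_vec_density_def cgauss_nonneg prod_nonneg)

lemma prob_space_cgauss_vec: "0 < v \<Longrightarrow> prob_space (cgauss_vec n v m)"
  unfolding cgauss_vec_def by (intro prob_space_PiM prob_space_cgauss)

lemma sets_cgauss_vec [simp, measurable_cong]: "sets (cgauss_vec n v m) = sets (lborels n)"
  unfolding cgauss_vec_def by (intro sets_PiM_cong) auto

lemma space_cgauss_vec [simp]: "space (cgauss_vec n v m) = space (lborels n)"
  by (intro sets_eq_imp_space_eq) simp

lemma sigma_finite_lborels: "sigma_finite_measure (lborels n)"
proof -
  interpret product_sigma_finite "\<lambda>_::nat. lborel :: complex measure" by standard
  show ?thesis by (rule sigma_finite) simp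
qed

lemma cgauss_vec_eq_density:
  assumes "0 < v"
  shows "cgauss_vec n v m = density (lborels n) (\<lambda>y. ennreal (cgauss_vec_density n v m y))"
proof -
  interpret product_sigma_finite "\<lambda>_::nat. lborel :: complex measure" by standard
  have "cgauss_vec n v m = density (lborels n) (\<lambda>y. \<Prod>t<n. ennreal (cgauss v (m t) (y t)))"
    unfolding cgauss_vec_def using assms
    by (intro PiM_density) (auto intro!: prob_space_imp_sigma_finite prob_space_cgauss)
  then show ?thesis
    using assms by (simp add: cgauss_vec_density_def prod_ennreal cgauss_nonneg)
qed

lemma measurable_cgauss_vec_density [measurable]:
  assumes "\<And>t. t < n \<Longrightarrow> (\<lambda>x. f x t) \<in> borel_measurable M"
    and "\<And>t. t < n \<Longrightarrow> (\<lambda>x. g x t) \<in> borel_measurable M"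
  shows "(\<lambda>x. cgauss_vec_density n v (f x) (g x)) \<in> borel_measurable M"
  unfolding cgauss_vec_density_def using assms
  by (intro borel_measurable_prod measurable_cgauss) auto

lemma emeasure_cgauss_vec:
  assumes "0 < v" "A \<in> sets (lborels n)"
  shows "emeasure (cgauss_vec n v m) A
    = (\<integral>\<^sup>+y. ennreal (cgauss_vec_density n v m y) * indicator A y \<partial>lborels n)"
  unfolding cgauss_vec_eq_density[OF assms(1)] using assms(2)
  by (intro emeasure_density measurable_compose[OF _ measurable_ennreal]
      measurable_cgauss_vec_density) (auto intro: measurable_component_singleton)

text \<open>
  The right-hand side is, up to the factor, a probability density of \<open>(y1, y2, y3)\<close> that does not
  depend on the transmitted \<open>u1\<close>, \<open>u2\<close>, so its integrals over disjoint decoding regions sum to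
  at most 1.
\<close>

lemma cgauss_triple_le:
  fixes a b u1 u2 y1 y2 y3 :: complex
  assumes \<rho>: "4 \<le> \<rho>" and \<tau>: "6 \<le> \<tau>" "6 * (cmod a)\<^sup>2 \<le> \<tau>" "6 * (cmod b)\<^sup>2 \<le> \<tau>"
  shows "cgauss 1 u1 y1 * cgauss 1 u2 y2 * cgauss 1 (a * u1 + b * u2) y3
    \<le> \<rho>\<^sup>2 * \<tau> * exp (2 * ((cmod u1)\<^sup>2 + (cmod u2)\<^sup>2) / \<rho>) *
      (cgauss \<rho> 0 y1 * cgauss \<rho> 0 y2 * cgauss \<tau> (a * y1 + b * y2) y3)"
proof -
  define d1 d2 d3 where "d1 = y1 - u1" and "d2 = y2 - u2" and "d3 = y3 - (a * u1 + b * u2)"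
  have sq2: "(x + y)\<^sup>2 \<le> 2 * x\<^sup>2 + 2 * y\<^sup>2" for x y :: real
    using sum_squares_bound[of x y] by (simp add: power2_sum)
  have sq3: "(x + y + z)\<^sup>2 \<le> 3 * (x\<^sup>2 + y\<^sup>2 + z\<^sup>2)" for x y z :: real
  proof -
    have "0 \<le> (x - y)\<^sup>2 + (y - z)\<^sup>2 + (x - z)\<^sup>2" by simp
    then show ?thesis by (simp add: power2_eq_square algebra_simps)
  qed
  have one: "(cmod y)\<^sup>2 / \<rho> \<le> 2 * (cmod u)\<^sup>2 / \<rho> + (cmod (y - u))\<^sup>2 / 2" for y u
  proof -
    have "(cmod y)\<^sup>2 \<le> (cmod u + cmod (y - u))\<^sup>2"
      using norm_triangle_ineq[of u "y - u"] by (intro power_mono) auto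
    also have "\<dots> \<le> 2 * (cmod u)\<^sup>2 + 2 * (cmod (y - u))\<^sup>2" by (rule sq2)
    also have "\<dots> \<le> 2 * (cmod u)\<^sup>2 + \<rho> / 2 * (cmod (y - u))\<^sup>2"
      using \<rho> by (intro add_mono mult_right_mono) auto
    finally show ?thesis using \<rho> by (simp add: field_simps)
  qed
  \<comment> \<open>The third residual is \<open>d3 - a * d1 - b * d2\<close>. Since \<tau>
    dominates 6, \<open>6 * (cmod a)\<^sup>2\<close> and \<open>6 * (cmod b)\<^sup>2\<close>, it
    costs half of each squared noise term; the other halves for \<open>d1\<close> and
    \<open>d2\<close> are spent in \<open>one\<close>.\<close>
  have "(cmod (y3 - (a * y1 + b * y2)))\<^sup>2 / \<tau> \<le> ((cmod d1)\<^sup>2 + (cmod d2)\<^sup>2 + (cmod d3)\<^sup>2) / 2"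
  proof -
    have "y3 - (a * y1 + b * y2) = d3 - a * d1 - b * d2"
      by (simp add: d1_def d2_def d3_def algebra_simps)
    then have "cmod (y3 - (a * y1 + b * y2)) \<le> cmod d3 + cmod a * cmod d1 + cmod b * cmod d2"
      using norm_triangle_ineq4[of "d3 - a * d1" "b * d2"] norm_triangle_ineq4[of d3 "a * d1"]
      by (simp add: norm_mult)
    then have "(cmod (y3 - (a * y1 + b * y2)))\<^sup>2 \<le> (cmod d3 + cmod a * cmod d1 + cmod b * cmod d2)\<^sup>2"
      by (intro power_mono) auto
    also have "\<dots> \<le> 3 * ((cmod d3)\<^sup>2 + (cmod a * cmod d1)\<^sup>2 + (cmod b * cmod d2)\<^sup>2)"
      by (rule sq3)
    also have "\<dots> = 3 * (cmod d3)\<^sup>2 + 3 * (cmod a)\<^sup>2 * (cmod d1)\<^sup>2 + 3 * (cmod b)\<^sup>2 * (cmod d2)\<^sup>2"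
      by (simp add: power_mult_distrib)
    also have "\<dots> \<le> \<tau> / 2 * (cmod d3)\<^sup>2 + \<tau> / 2 * (cmod d1)\<^sup>2 + \<tau> / 2 * (cmod d2)\<^sup>2"
      using \<tau> by (intro add_mono mult_right_mono) auto
    finally show ?thesis using \<tau> by (simp add: field_simps)
  qed
  with one[of y1 u1] one[of y2 u2]
  have le: "- (cmod d1)\<^sup>2 - (cmod d2)\<^sup>2 - (cmod d3)\<^sup>2 \<le>
    2 * ((cmod u1)\<^sup>2 + (cmod u2)\<^sup>2) / \<rho> - (cmod y1)\<^sup>2 / \<rho> - (cmod y2)\<^sup>2 / \<rho>
    - (cmod (y3 - (a * y1 + b * y2)))\<^sup>2 / \<tau>"
    unfolding d1_def[symmetric] d2_def[symmetric]
    using zero_le_power2[of "cmod d3"] unfolding distrib_left add_divide_distrib by linarith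
  have "cgauss 1 u1 y1 * cgauss 1 u2 y2 * cgauss 1 (a * u1 + b * u2) y3
    = exp (- (cmod d1)\<^sup>2 - (cmod d2)\<^sup>2 - (cmod d3)\<^sup>2) / pi ^ 3"
    by (simp add: cgauss_def d1_def d2_def d3_def exp_add exp_diff exp_minus field_simps power3_eq_cube)
  also have "\<dots> \<le> exp (2 * ((cmod u1)\<^sup>2 + (cmod u2)\<^sup>2) / \<rho> - (cmod y1)\<^sup>2 / \<rho> - (cmod y2)\<^sup>2 / \<rho>
    - (cmod (y3 - (a * y1 + b * y2)))\<^sup>2 / \<tau>) / pi ^ 3"
    using le by (intro divide_right_mono) auto
  also have "\<dots> = \<rho>\<^sup>2 * \<tau> * exp (2 * ((cmod u1)\<^sup>2 + (cmod u2)\<^sup>2) / \<rho>) *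
      (cgauss \<rho> 0 y1 * cgauss \<rho> 0 y2 * cgauss \<tau> (a * y1 + b * y2) y3)"
  proof -
    have "exp (A - x - y - z) / pi ^ 3 = \<rho>\<^sup>2 * \<tau> * exp A *
      (exp (- x) / (pi * \<rho>) * (exp (- y) / (pi * \<rho>)) * (exp (- z) / (pi * \<tau>)))" for A x y z :: real
      using \<rho> \<tau> by (simp add: exp_diff exp_minus exp_add field_simps power3_eq_cube power2_eq_square)
    then show ?thesis by (simp add: cgauss_def)
  qed
  finally show ?thesis .
qed

text \<open>The single-letter bounds multiply, and their exponents add up to the energy of the whole
  block.\<close>

lemma cgauss_vec_density_triple_le:
  fixes a b :: complex
  assumes \<rho>: "4 \<le> \<rho>" and \<tau>: "6 \<le> \<tau>" "6 * (cmod a)\<^sup>2 \<le> \<tau>" "6 * (cmod b)\<^sup>2 \<le> \<tau>"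
    and B: "(\<Sum>t<n. (cmod (u1 t))\<^sup>2 + (cmod (u2 t))\<^sup>2) \<le> B"
  shows "cgauss_vec_density n 1 u1 y1 * cgauss_vec_density n 1 u2 y2 *
      cgauss_vec_density n 1 (\<lambda>t. a * u1 t + b * u2 t) y3
    \<le> (\<rho>\<^sup>2 * \<tau>) ^ n * exp (2 * B / \<rho>) *
      (cgauss_vec_density n \<rho> (\<lambda>_. 0) y1 * cgauss_vec_density n \<rho> (\<lambda>_. 0) y2 *
       cgauss_vec_density n \<tau> (\<lambda>t. a * y1 t + b * y2 t) y3)"
    (is "?l \<le> _ * ?r")
proof -
  have "?l = (\<Prod>t<n. cgauss 1 (u1 t) (y1 t) * cgauss 1 (u2 t) (y2 t) *
      cgauss 1 (a * u1 t + b * u2 t) (y3 t))"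
    by (simp add: cgauss_vec_density_def prod.distrib)
  also have "\<dots> \<le> (\<Prod>t<n. \<rho>\<^sup>2 * \<tau> * exp (2 * ((cmod (u1 t))\<^sup>2 + (cmod (u2 t))\<^sup>2) / \<rho>) *
      (cgauss \<rho> 0 (y1 t) * cgauss \<rho> 0 (y2 t) * cgauss \<tau> (a * y1 t + b * y2 t) (y3 t)))"
    using cgauss_triple_le[OF \<rho> \<tau>]
    by (intro prod_mono conjI mult_nonneg_nonneg cgauss_nonneg) auto
  also have "\<dots> = (\<rho>\<^sup>2 * \<tau>) ^ n * exp (2 * (\<Sum>t<n. (cmod (u1 t))\<^sup>2 + (cmod (u2 t))\<^sup>2) / \<rho>) * ?r"
    by (simp add: cgauss_vec_density_def prod.distrib exp_sum[symmetric] power_mult_distrib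
      sum_distrib_left sum_divide_distrib)
  also have "\<dots> \<le> (\<rho>\<^sup>2 * \<tau>) ^ n * exp (2 * B / \<rho>) * ?r"
    using \<rho> \<tau> B by (intro mult_right_mono mult_left_mono mult_nonneg_nonneg
      cgauss_vec_density_nonneg) (auto simp: divide_right_mono)
  finally show ?thesis .
qed

text \<open>The pointwise bound is integrated over \<open>A1\<close>, \<open>A2\<close> and
  \<open>D w\<close>. The dominating density is the same for all \<open>w\<close>, and the regions
  \<open>D w\<close> are disjoint, so the kernel in \<open>y3\<close> contributes at most 1 in
  total; what remains is the mass of \<open>A1\<close> times that of \<open>A2\<close>. Later
  \<open>W\<close> consists of codewords sharing one message of the first user, whence the common
  \<open>A1\<close> and \<open>A2\<close>.\<close>

lemma sum_emeasure_cgauss_vec_le: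
  fixes a b :: complex
  assumes \<rho>: "4 \<le> \<rho>" and \<tau>: "6 \<le> \<tau>" "6 * (cmod a)\<^sup>2 \<le> \<tau>" "6 * (cmod b)\<^sup>2 \<le> \<tau>"
    and W: "finite W"
    and B: "\<And>w. w \<in> W \<Longrightarrow> (\<Sum>t<n. (cmod (u1 w t))\<^sup>2 + (cmod (u2 w t))\<^sup>2) \<le> B"
    and A1[measurable]: "A1 \<in> sets (lborels n)" and A2[measurable]: "A2 \<in> sets (lborels n)"
    and D: "\<And>w. w \<in> W \<Longrightarrow> D w \<in> sets (lborels n)" and disj: "disjoint_family_on D W"
  shows "(\<Sum>w\<in>W. emeasure (cgauss_vec n 1 (u1 w)) A1 * emeasure (cgauss_vec n 1 (u2 w)) A2 *
      emeasure (cgauss_vec n 1 (\<lambda>t. a * u1 w t + b * u2 w t)) (D w))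
    \<le> ennreal ((\<rho>\<^sup>2 * \<tau>) ^ n * exp (2 * B / \<rho>)) *
      (emeasure (cgauss_vec n \<rho> (\<lambda>_. 0)) A1 * emeasure (cgauss_vec n \<rho> (\<lambda>_. 0)) A2)"
    (is "(\<Sum>w\<in>W. ?P w) \<le> ennreal ?L * _")
proof -
  interpret L: sigma_finite_measure "lborels n" by (rule sigma_finite_lborels)
  interpret LL: pair_sigma_finite "lborels n" "lborels n" ..
  let ?d = "cgauss_vec_density n"
  have comp: "(\<lambda>x. f x t) \<in> borel_measurable M" if "f \<in> M \<rightarrow>\<^sub>M lborels n" "t < n" for f t M
    using measurable_compose[OF that(1), of "\<lambda>x. x t" lborel] that(2)
      measurable_component_singleton[of t "{..<n}" "\<lambda>_. lborel"] by auto
  have dens [measurable]: "(\<lambda>x. ennreal (?d v u (g x))) \<in> borel_measurable M"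
    if "g \<in> M \<rightarrow>\<^sub>M lborels n" for v u g M
    by (intro measurable_compose[OF _ measurable_ennreal] measurable_cgauss_vec_density
        borel_measurable_const comp[OF that]) auto
  have dens3 [measurable]: "(\<lambda>x. ennreal (?d \<tau> (\<lambda>t. a * f x t + b * g x t) (h x))) \<in> borel_measurable M"
    if "f \<in> M \<rightarrow>\<^sub>M lborels n" "g \<in> M \<rightarrow>\<^sub>M lborels n" "h \<in> M \<rightarrow>\<^sub>M lborels n" for f g h M
    by (intro measurable_compose[OF _ measurable_ennreal] measurable_cgauss_vec_density
        borel_measurable_add borel_measurable_times borel_measurable_const comp that) auto
  define G where "G w y1 y2 y3 = ennreal (?d \<rho> (\<lambda>_. 0) y1) * indicator A1 y1 *
    (ennreal (?d \<rho> (\<lambda>_. 0) y2) * indicator A2 y2) *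
    (ennreal (?d \<tau> (\<lambda>t. a * y1 t + b * y2 t) y3) * indicator (D w) y3)" for w y1 y2 y3
  have Gm3 [measurable]: "(\<lambda>x. G w (f x) (g x) (h x)) \<in> borel_measurable M"
    if "w \<in> W" "f \<in> M \<rightarrow>\<^sub>M lborels n" "g \<in> M \<rightarrow>\<^sub>M lborels n" "h \<in> M \<rightarrow>\<^sub>M lborels n" for w f g h M
    using D[OF that(1), measurable] that(2-4)[measurable] unfolding G_def by measurable
  have Gm2: "(\<lambda>x. \<integral>\<^sup>+y3. G w (f x) (g x) y3 \<partial>lborels n) \<in> borel_measurable M"
    if "w \<in> W" "f \<in> M \<rightarrow>\<^sub>M lborels n" "g \<in> M \<rightarrow>\<^sub>M lborels n" for w f g M
    using that by (intro L.borel_measurable_nn_integral) (simp add: split_beta')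
  have Gm1: "(\<lambda>x. \<integral>\<^sup>+y2. \<integral>\<^sup>+y3. G w (f x) y2 y3 \<partial>lborels n \<partial>lborels n) \<in> borel_measurable M"
    if "w \<in> W" "f \<in> M \<rightarrow>\<^sub>M lborels n" for w f M
    using that by (intro L.borel_measurable_nn_integral) (simp add: split_beta' Gm2)
  have Gm: "G w y1 y2 \<in> borel_measurable (lborels n)"
    "(\<lambda>y2. \<integral>\<^sup>+y3. G w y1 y2 y3 \<partial>lborels n) \<in> borel_measurable (lborels n)"
    "(\<lambda>y1. \<integral>\<^sup>+y2. \<integral>\<^sup>+y3. G w y1 y2 y3 \<partial>lborels n \<partial>lborels n) \<in> borel_measurable (lborels n)"
    if w: "w \<in> W" and y: "y1 \<in> space (lborels n)" "y2 \<in> space (lborels n)" for w y1 y2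
    by (intro Gm3 Gm2 Gm1 w measurable_const y measurable_ident_sets refl)+
  have P: "?P w \<le> ennreal ?L * (\<integral>\<^sup>+y1. \<integral>\<^sup>+y2. \<integral>\<^sup>+y3. G w y1 y2 y3 \<partial>lborels n \<partial>lborels n \<partial>lborels n)"
    if w: "w \<in> W" for w
  proof -
    note [measurable] = D[OF w]
    have "?P w = (\<integral>\<^sup>+y1. \<integral>\<^sup>+y2. \<integral>\<^sup>+y3.
        ennreal (?d 1 (u1 w) y1) * indicator A1 y1 * (ennreal (?d 1 (u2 w) y2) * indicator A2 y2) *
        (ennreal (?d 1 (\<lambda>t. a * u1 w t + b * u2 w t) y3) * indicator (D w) y3)
        \<partial>lborels n \<partial>lborels n \<partial>lborels n)"
      by (simp add: emeasure_cgauss_vec D[OF w] nn_integral_cmult nn_integral_multc)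
    also have "\<dots> \<le> (\<integral>\<^sup>+y1. \<integral>\<^sup>+y2. \<integral>\<^sup>+y3. ennreal ?L * G w y1 y2 y3 \<partial>lborels n \<partial>lborels n \<partial>lborels n)"
    proof (intro nn_integral_mono)
      fix y1 y2 y3
      have "ennreal (?d 1 (u1 w) y1 * ?d 1 (u2 w) y2 * ?d 1 (\<lambda>t. a * u1 w t + b * u2 w t) y3)
        \<le> ennreal (?L * (?d \<rho> (\<lambda>_. 0) y1 * ?d \<rho> (\<lambda>_. 0) y2 * ?d \<tau> (\<lambda>t. a * y1 t + b * y2 t) y3))"
        by (intro ennreal_leI cgauss_vec_density_triple_le \<rho> \<tau> B w)
      then show "ennreal (?d 1 (u1 w) y1) * indicator A1 y1 * (ennreal (?d 1 (u2 w) y2) * indicator A2 y2) *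
        (ennreal (?d 1 (\<lambda>t. a * u1 w t + b * u2 w t) y3) * indicator (D w) y3)
        \<le> ennreal ?L * G w y1 y2 y3"
        using \<rho> \<tau> by (auto simp: G_def indicator_def ennreal_mult cgauss_vec_density_nonneg mult.assoc)
    qed
    also have "\<dots> = ennreal ?L * (\<integral>\<^sup>+y1. \<integral>\<^sup>+y2. \<integral>\<^sup>+y3. G w y1 y2 y3 \<partial>lborels n \<partial>lborels n \<partial>lborels n)"
      using w by (simp add: nn_integral_cmult Gm cong: nn_integral_cong_simp)
    finally show ?thesis .
  qed
  have "(\<Sum>w\<in>W. ?P w) \<le> ennreal ?L *
      (\<Sum>w\<in>W. \<integral>\<^sup>+y1. \<integral>\<^sup>+y2. \<integral>\<^sup>+y3. G w y1 y2 y3 \<partial>lborels n \<partial>lborels n \<partial>lborels n)"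
    unfolding sum_distrib_left by (intro sum_mono P)
  also have "(\<Sum>w\<in>W. \<integral>\<^sup>+y1. \<integral>\<^sup>+y2. \<integral>\<^sup>+y3. G w y1 y2 y3 \<partial>lborels n \<partial>lborels n \<partial>lborels n)
      = (\<integral>\<^sup>+y1. \<integral>\<^sup>+y2. \<integral>\<^sup>+y3. (\<Sum>w\<in>W. G w y1 y2 y3) \<partial>lborels n \<partial>lborels n \<partial>lborels n)"
    by (simp add: nn_integral_sum Gm cong: nn_integral_cong_simp)
  also have "\<dots> \<le> (\<integral>\<^sup>+y1. \<integral>\<^sup>+y2. ennreal (?d \<rho> (\<lambda>_. 0) y1) * indicator A1 y1 *
      (ennreal (?d \<rho> (\<lambda>_. 0) y2) * indicator A2 y2) \<partial>lborels n \<partial>lborels n)"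
  proof (intro nn_integral_mono)
    fix y1 y2 assume y: "y1 \<in> space (lborels n)" "y2 \<in> space (lborels n)"
    let ?K = "\<lambda>y3. ennreal (?d \<tau> (\<lambda>t. a * y1 t + b * y2 t) y3)"
    let ?c = "ennreal (?d \<rho> (\<lambda>_. 0) y1) * indicator A1 y1 * (ennreal (?d \<rho> (\<lambda>_. 0) y2) * indicator A2 y2)"
    have [measurable]: "?K \<in> borel_measurable (lborels n)"
      by (intro dens3 measurable_const y measurable_ident_sets refl)
    have "(\<Sum>w\<in>W. indicator (D w) y :: ennreal) \<le> 1" for y
      using W disj by (simp flip: indicator_UN_disjoint) (simp add: indicator_def)
    then have "?c * ?K y3 * (\<Sum>w\<in>W. indicator (D w) y3) \<le> ?c * ?K y3 * 1" for y3
      by (intro mult_left_mono) auto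
    then have "(\<Sum>w\<in>W. G w y1 y2 y3) \<le> ?c * ?K y3" for y3
      by (simp only: G_def sum_distrib_left mult.assoc mult_1_right)
    then have "(\<integral>\<^sup>+y3. (\<Sum>w\<in>W. G w y1 y2 y3) \<partial>lborels n) \<le> (\<integral>\<^sup>+y3. ?c * ?K y3 \<partial>lborels n)"
      by (intro nn_integral_mono)
    also have "\<dots> = ?c * (\<integral>\<^sup>+y3. ?K y3 \<partial>lborels n)"
      by (intro nn_integral_cmult) measurable
    also have "(\<integral>\<^sup>+y3. ?K y3 \<partial>lborels n) = emeasure (cgauss_vec n \<tau> (\<lambda>t. a * y1 t + b * y2 t)) (space (lborels n))"
      using \<tau> by (subst emeasure_cgauss_vec) (auto intro!: nn_integral_cong)
    also have "\<dots> = 1"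
      using prob_space.emeasure_space_1[OF prob_space_cgauss_vec, of \<tau>] \<tau> by simp
    finally show "(\<integral>\<^sup>+y3. (\<Sum>w\<in>W. G w y1 y2 y3) \<partial>lborels n) \<le> ?c" by simp
  qed
  also have "\<dots> = emeasure (cgauss_vec n \<rho> (\<lambda>_. 0)) A1 * emeasure (cgauss_vec n \<rho> (\<lambda>_. 0)) A2"
    using \<rho> by (simp add: emeasure_cgauss_vec nn_integral_cmult nn_integral_multc)
  finally show ?thesis by (simp add: mult_left_mono)
qed

text \<open>The signal only translates the noise, coordinate by coordinate, so translation
  invariance of Lebesgue measure gives the claim on boxes.\<close>

lemma distr_noise_received:
  "distr (noise n) (PiM {..<n} (\<lambda>_. borel)) (received n h x)
    = cgauss_vec n 1 (\<lambda>t. \<Sum>i\<in>UNIV. h $ i * x t $ i)"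
proof -
  define u where "u t = (\<Sum>i\<in>UNIV. h $ i * x t $ i)" for t
  interpret product_sigma_finite "\<lambda>t::nat. density lborel (\<lambda>z. ennreal (cgauss 1 (u t) z))"
    by (intro product_sigma_finite.intro prob_space_imp_sigma_finite prob_space_cgauss) simp
  interpret N: product_sigma_finite "\<lambda>t::nat. complex_gaussian"
    unfolding complex_gaussian_eq
    by (intro product_sigma_finite.intro prob_space_imp_sigma_finite prob_space_cgauss) simp
  have [measurable_cong]: "sets complex_gaussian = sets borel"
    by (simp add: complex_gaussian_def)
  have rec: "received n h x = (\<lambda>z. \<lambda>t\<in>{..<n}. u t + z t)"
    by (simp add: received_def u_def fun_eq_iff)
  have [measurable]: "received n h x \<in> noise n \<rightarrow>\<^sub>M PiM {..<n} (\<lambda>_. borel)"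
    unfolding rec noise_def by measurable
  have "distr (noise n) (PiM {..<n} (\<lambda>_. borel)) (received n h x)
    = PiM {..<n} (\<lambda>t. density lborel (\<lambda>z. ennreal (cgauss 1 (u t) z)))"
  proof (rule PiM_eqI)
    show "sets (distr (noise n) (PiM {..<n} (\<lambda>_. borel)) (received n h x)) =
      sets (PiM {..<n} (\<lambda>t. density lborel (\<lambda>z. ennreal (cgauss 1 (u t) z))))"
      by (simp cong: sets_PiM_cong)
    fix A assume "\<And>t. t \<in> {..<n} \<Longrightarrow> A t \<in> sets (density lborel (\<lambda>z. ennreal (cgauss 1 (u t) z)))"
    then have A [measurable]: "\<And>t. t \<in> {..<n} \<Longrightarrow> A t \<in> sets borel" by simp
    have "emeasure (distr (noise n) (PiM {..<n} (\<lambda>_. borel)) (received n h x)) (Pi\<^sub>E {..<n} A)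
      = emeasure (noise n) (received n h x -` (Pi\<^sub>E {..<n} A) \<inter> space (noise n))"
      by (intro emeasure_distr) (auto intro!: sets_PiM_I_finite)
    also have "received n h x -` (Pi\<^sub>E {..<n} A) \<inter> space (noise n)
      = (\<Pi>\<^sub>E t\<in>{..<n}. (\<lambda>z. u t + z) -` A t)"
      by (auto simp: rec noise_def space_PiM complex_gaussian_def PiE_iff)
    also have "emeasure (noise n) \<dots> = (\<Prod>t<n. emeasure complex_gaussian ((\<lambda>z. u t + z) -` A t))"
    proof -
      have "(\<lambda>z. u t + z) -` A t \<in> sets borel" if "t < n" for t
        using measurable_sets_borel[of "\<lambda>z. u t + z" borel "A t"] A[of t] that by simp
      then show ?thesis
        unfolding noise_def by (intro N.emeasure_PiM) (auto simp: complex_gaussian_def)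
    qed
    also have "\<dots> = (\<Prod>t<n. emeasure (density lborel (\<lambda>z. ennreal (cgauss 1 (u t) z))) (A t))"
    proof (intro prod.cong refl)
      fix t assume t: "t \<in> {..<n}"
      note [measurable] = A[OF t]
      have "emeasure (density lborel (\<lambda>z. ennreal (cgauss 1 (u t) z))) (A t)
        = (\<integral>\<^sup>+z. ennreal (cgauss 1 (u t) z) * indicator (A t) z \<partial>distr lborel borel ((+) (u t)))"
        by (subst emeasure_density) (auto simp: lborel_distr_plus)
      also have "\<dots> = (\<integral>\<^sup>+z. ennreal (cgauss 1 0 z) * indicator ((\<lambda>z. u t + z) -` A t) z \<partial>lborel)"
        by (subst nn_integral_distr) (auto simp: cgauss_def indicator_def)
      also have "\<dots> = emeasure complex_gaussian ((\<lambda>z. u t + z) -` A t)"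
        using measurable_sets_borel[of "\<lambda>z. u t + z" borel "A t"]
        unfolding complex_gaussian_eq by (subst emeasure_density) auto
      finally show "emeasure complex_gaussian ((\<lambda>z. u t + z) -` A t)
        = emeasure (density lborel (\<lambda>z. ennreal (cgauss 1 (u t) z))) (A t)" ..
    qed
    finally show "emeasure (distr (noise n) (PiM {..<n} (\<lambda>_. borel)) (received n h x)) (Pi\<^sub>E {..<n} A)
      = (\<Prod>t<n. emeasure (density lborel (\<lambda>z. ennreal (cgauss 1 (u t) z))) (A t))" .
  qed simp
  then show ?thesis by (simp add: cgauss_vec_def u_def)
qed

section \<open>Upper bound\<close>

lemma sum_measure_cgauss_vec_le:
  fixes a b :: complex
  assumes \<rho>: "4 \<le> \<rho>" and \<tau>: "6 \<le> \<tau>" "6 * (cmod a)\<^sup>2 \<le> \<tau>" "6 * (cmod b)\<^sup>2 \<le> \<tau>"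
    and W: "finite W"
    and B: "\<And>w. w \<in> W \<Longrightarrow> (\<Sum>t<n. (cmod (u1 w t))\<^sup>2 + (cmod (u2 w t))\<^sup>2) \<le> B"
    and A: "A1 \<in> sets (lborels n)" "A2 \<in> sets (lborels n)"
    and D: "\<And>w. w \<in> W \<Longrightarrow> D w \<in> sets (lborels n)" and disj: "disjoint_family_on D W"
  shows "(\<Sum>w\<in>W. measure (cgauss_vec n 1 (u1 w)) A1 * measure (cgauss_vec n 1 (u2 w)) A2 *
      measure (cgauss_vec n 1 (\<lambda>t. a * u1 w t + b * u2 w t)) (D w))
    \<le> (\<rho>\<^sup>2 * \<tau>) ^ n * exp (2 * B / \<rho>) *
      (measure (cgauss_vec n \<rho> (\<lambda>_. 0)) A1 * measure (cgauss_vec n \<rho> (\<lambda>_. 0)) A2)"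
proof -
  have em: "emeasure (cgauss_vec n v m) S = ennreal (measure (cgauss_vec n v m) S)" if "0 < v" for v m S
    using prob_space_cgauss_vec[OF that] by (simp add: prob_space_def finite_measure.emeasure_eq_measure)
  show ?thesis
    using sum_emeasure_cgauss_vec_le[OF assms] \<rho> \<tau>
    by (simp add: em ennreal_mult[symmetric] sum_nonneg)
qed

text \<open>Passes from error events in the noise space to decoding regions in the space of received
  vectors, where the regions of different messages are disjoint.\<close>

lemma measure_correct_decoding:
  assumes dec: "dec \<in> PiM {..<n} (\<lambda>_. borel) \<rightarrow>\<^sub>M count_space UNIV"
  shows "measure (cgauss_vec n 1 (\<lambda>t. \<Sum>i\<in>UNIV. h $ i * x t $ i)) (dec -` {w} \<inter> space (lborels n))
    = 1 - measure (noise n) {z \<in> space (noise n). dec (received n h x z) \<noteq> w}"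
proof -
  let ?Q = "cgauss_vec n 1 (\<lambda>t. \<Sum>i\<in>UNIV. h $ i * x t $ i)"
  interpret Q: prob_space ?Q by (rule prob_space_cgauss_vec) simp
  have sets_eq: "sets (lborels n) = sets (PiM {..<n} (\<lambda>_. borel))"
    by (intro sets_PiM_cong) auto
  have space_eq: "space (lborels n) = space (PiM {..<n} (\<lambda>_. borel))"
    using sets_eq by (rule sets_eq_imp_space_eq)
  have [measurable_cong]: "sets complex_gaussian = sets borel"
    by (simp add: complex_gaussian_def)
  have rec: "received n h x \<in> noise n \<rightarrow>\<^sub>M PiM {..<n} (\<lambda>_. borel)"
    unfolding received_def noise_def by measurable
  have S: "dec -` S \<inter> space (lborels n) \<in> sets (PiM {..<n} (\<lambda>_. borel))" for S
    unfolding space_eq using dec by (rule measurable_sets) simp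
  have "measure (noise n) {z \<in> space (noise n). dec (received n h x z) \<noteq> w}
    = measure (distr (noise n) (PiM {..<n} (\<lambda>_. borel)) (received n h x)) (dec -` (-{w}) \<inter> space (lborels n))"
    using rec S measurable_space[OF rec] unfolding space_eq
    by (subst measure_distr) (auto intro!: arg_cong2[where f = measure])
  also have "\<dots> = measure ?Q (space ?Q - (dec -` {w} \<inter> space (lborels n)))"
    unfolding distr_noise_received by (intro arg_cong2[where f = measure]) auto
  also have "\<dots> = 1 - measure ?Q (dec -` {w} \<inter> space (lborels n))"
    using S[of "{w}"] sets_eq by (intro Q.prob_compl) simp
  finally show ?thesis by simp
qed

text \<open>Cauchy-Schwarz, applied to the moduli because the product is bilinear.\<close>

lemma cmod_row_times_column_le:
  fixes h x :: "complex ^ 'm::finite"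
  shows "(cmod (\<Sum>i\<in>UNIV. h $ i * x $ i))\<^sup>2 \<le> (norm h)\<^sup>2 * (norm x)\<^sup>2"
proof -
  have "cmod (\<Sum>i\<in>UNIV. h $ i * x $ i) \<le> (\<Sum>i\<in>UNIV. cmod (h $ i) * cmod (x $ i))"
    by (rule order_trans[OF norm_sum]) (simp add: norm_mult)
  also have "\<dots> \<le> norm h * norm x"
    using L2_set_mult_ineq[of "\<lambda>i. cmod (h $ i)" "\<lambda>i. cmod (x $ i)" UNIV] by (simp add: norm_vec_def)
  finally show ?thesis
    using power_mono[of "cmod (\<Sum>i\<in>UNIV. h $ i * x $ i)" "norm h * norm x" 2]
    by (simp add: power_mult_distrib)
qed

lemma finite_messages: "finite (messages n R)"
  unfolding messages_def by (intro finite_PiE) auto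

lemma card_messages: "card (messages n (R :: 'k::finite \<Rightarrow> real)) = (\<Prod>k\<in>UNIV. nat \<lceil>2 powr (real n * R k)\<rceil>)"
  unfolding messages_def by (simp add: card_PiE)

text \<open>
  States \<open>j1\<close> and \<open>j2\<close> of user \<open>k\<close> together determine the signal of user \<open>k'\<close>. For a fixed
  message of user \<open>k\<close>, all messages of user \<open>k'\<close> therefore have to be packed into the product of
  the two decoding regions of that message.
\<close>

lemma rate_tradeoff_code:
  fixes H :: "('m::finite, 'j::finite, 'k::finite) channel_states" and j0 j1 j2 :: 'j
  assumes UNIV: "(UNIV :: 'k set) = {k, k'}" and kk': "k \<noteq> k'"
    and ab: "\<And>i. H $ k' $ j0 $ i = a * H $ k $ j1 $ i + b * H $ k $ j2 $ i"
    and \<tau>: "6 \<le> \<tau>" "6 * (cmod a)\<^sup>2 \<le> \<tau>" "6 * (cmod b)\<^sup>2 \<le> \<tau>"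
    and P: "4 \<le> P" and n: "0 < n"
    and dec: "\<And>s l. dec s l \<in> PiM {..<n} (\<lambda>_. borel) \<rightarrow>\<^sub>M count_space UNIV"
    and pow: "average_power n R enc \<le> P"
    and err: "\<And>s l. error_probability H n R enc dec s l \<le> 1 / 12"
  shows "(2 powr (real n * R k))\<^sup>2 * 2 powr (real n * R k')
    \<le> 4 * (P\<^sup>2 * \<tau> * exp (8 * ((norm (H $ k $ j1))\<^sup>2 + (norm (H $ k $ j2))\<^sup>2))) ^ n"
proof -
  define M where "M = messages n R"
  define m where "m l = nat \<lceil>2 powr (real n * R l)\<rceil>" for l
  define hh where "hh = (norm (H $ k $ j1))\<^sup>2 + (norm (H $ k $ j2))\<^sup>2"
  define L where "L = (P\<^sup>2 * \<tau> * exp (8 * hh)) ^ n"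
  have L: "0 \<le> L" using \<tau> by (simp add: L_def)
  have fM: "finite M" unfolding M_def by (rule finite_messages)
  have cM: "card M = m k * m k'"
    using kk' by (simp add: M_def card_messages UNIV m_def)
  have m: "2 powr (real n * R l) \<le> m l" "0 < m l" for l
  proof -
    show "2 powr (real n * R l) \<le> m l" unfolding m_def by linarith
    moreover have "0 < 2 powr (real n * R l)" by simp
    ultimately show "0 < m l" by linarith
  qed
  have Mlt: "w l < m l" if "w \<in> M" for w l
    using that by (auto simp: M_def messages_def m_def)
  define u1 u2 where "u1 w t = (\<Sum>i\<in>UNIV. H $ k $ j1 $ i * enc w t $ i)"
    and "u2 w t = (\<Sum>i\<in>UNIV. H $ k $ j2 $ i * enc w t $ i)" for w t
  have u3: "(\<Sum>i\<in>UNIV. H $ k' $ j0 $ i * enc w t $ i) = a * u1 w t + b * u2 w t" for w t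
    by (simp add: u1_def u2_def ab sum_distrib_left sum.distrib[symmetric] algebra_simps)
  \<comment> \<open>Decoders see the states of all users; the constant state tuples are one choice
    that puts the relevant user into the desired state.\<close>
  define A1 A2 D where "A1 c = dec (\<lambda>_. j1) k -` {c} \<inter> space (lborels n)"
    and "A2 c = dec (\<lambda>_. j2) k -` {c} \<inter> space (lborels n)"
    and "D w = dec (\<lambda>_. j0) k' -` {w k'} \<inter> space (lborels n)" for c :: nat and w :: "'k \<Rightarrow> nat"
  have sets_eq: "sets (lborels n) = sets (PiM {..<n} (\<lambda>_. borel))"
    by (intro sets_PiM_cong) auto
  have meas: "dec s l -` S \<inter> space (lborels n) \<in> sets (lborels n)" for s l S
    using measurable_sets[OF dec[of s l], of S] sets_eq_imp_space_eq[OF sets_eq] sets_eq by simp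
  define e where "e s l w = measure (noise n)
    {z \<in> space (noise n). dec (\<lambda>_. s) l (received n (H $ l $ s) (enc w) z) \<noteq> w l}" for s l w
  have e: "(\<Sum>w\<in>M. e s l w) \<le> card M / 12" for s l
    using err[of "\<lambda>_. s" l] m cM
    by (simp add: error_probability_def M_def[symmetric] e_def[symmetric] field_simps)
  define p where "p w = (\<Sum>t<n. (norm (enc w t))\<^sup>2)" for w
  have "(\<Sum>w\<in>M. p w) \<le> card M * n * P"
    using pow m cM n
    by (simp add: average_power_def M_def[symmetric] p_def[symmetric] sum_divide_distrib[symmetric] field_simps)
  \<comment> \<open>Codewords with more than four times the allowed mean energy are discarded. By
    Markov's inequality this loses at most a quarter of the messages; with three errors of at most
    1/12 each, half of the total weight survives.\<close>
  then have p: "(\<Sum>w\<in>M. p w / (4 * n * P)) \<le> card M / 4"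
    using n P by (simp add: sum_divide_distrib[symmetric] field_simps)
  define c1 c2 c3 where "c1 w = measure (cgauss_vec n 1 (u1 w)) (A1 (w k))"
    and "c2 w = measure (cgauss_vec n 1 (u2 w)) (A2 (w k))"
    and "c3 w = measure (cgauss_vec n 1 (\<lambda>t. a * u1 w t + b * u2 w t)) (D w)" for w
  have c: "c1 w = 1 - e j1 k w" "c2 w = 1 - e j2 k w" "c3 w = 1 - e j0 k' w" for w
    unfolding c1_def c2_def c3_def A1_def A2_def D_def e_def u3[symmetric]
    unfolding u1_def u2_def by (rule measure_correct_decoding[OF dec])+
  have prob: "0 \<le> measure (cgauss_vec n v u) S \<and> measure (cgauss_vec n v u) S \<le> 1" if "0 < v" for v u S
    using prob_space.prob_le_1[OF prob_space_cgauss_vec[OF that]] by simp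
  have c01: "0 \<le> c1 w" "c1 w \<le> 1" "0 \<le> c2 w" "c2 w \<le> 1" "0 \<le> c3 w" "c3 w \<le> 1" for w
    unfolding c1_def c2_def c3_def using prob by simp_all
  define good where "good w \<longleftrightarrow> p w \<le> 4 * n * P" for w
  \<comment> \<open>Weight of success in three uses of the same codeword with independent noise:
    user \<open>k\<close> in both of its states and user \<open>k'\<close> in one.\<close>
  define q where "q w = (if good w then c1 w * c2 w * c3 w else 0)" for w
  have q01: "0 \<le> q w" "q w \<le> 1" for w
    using c01[of w] by (auto simp: q_def mult_le_one)
  have qlow: "1 - e j1 k w - e j2 k w - e j0 k' w - p w / (4 * n * P) \<le> q w" for w
  proof (cases "good w")
    case True
    have "0 \<le> p w / (4 * n * P)" using P by (simp add: p_def sum_nonneg)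
    moreover have "c1 w + c2 w - 1 \<le> c1 w * c2 w"
      using mult_nonneg_nonneg[of "1 - c1 w" "1 - c2 w"] c01[of w] by (simp add: algebra_simps)
    moreover have "c1 w * c2 w + c3 w - 1 \<le> c1 w * c2 w * c3 w"
      using mult_nonneg_nonneg[of "1 - c1 w * c2 w" "1 - c3 w"] c01[of w] mult_le_one[of "c1 w" "c2 w"]
      by (simp add: algebra_simps)
    ultimately show ?thesis using True c[of w] by (simp add: q_def)
  next
    case False
    then have "1 < p w / (4 * n * P)" using n P by (simp add: good_def field_simps)
    then show ?thesis using c[of w] c01[of w] False by (simp add: q_def)
  qed
  have "card M / 2 \<le> (\<Sum>w\<in>M. 1 - e j1 k w - e j2 k w - e j0 k' w - p w / (4 * n * P))"
    using e[of j1 k] e[of j2 k] e[of j0 k'] p by (simp add: sum_subtractf)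
  also have "\<dots> \<le> (\<Sum>w\<in>M. q w)" by (intro sum_mono qlow)
  also have "\<dots> = (\<Sum>c<m k. \<Sum>w\<in>{w \<in> M. w k = c}. q w)"
    using fM Mlt by (intro sum.group[symmetric]) auto
  also have "\<dots> \<le> (\<Sum>c<m k. sqrt (m k' * L) *
      ((measure (cgauss_vec n P (\<lambda>_. 0)) (A1 c) + measure (cgauss_vec n P (\<lambda>_. 0)) (A2 c)) / 2))"
  proof (intro sum_mono)
    fix c
    let ?F = "{w \<in> M. w k = c}" and ?T = "\<Sum>w\<in>{w \<in> M. w k = c}. q w"
    let ?\<nu>1 = "measure (cgauss_vec n P (\<lambda>_. 0)) (A1 c)" and ?\<nu>2 = "measure (cgauss_vec n P (\<lambda>_. 0)) (A2 c)"
    \<comment> \<open>With the message of \<open>k\<close> fixed, that of \<open>k'\<close>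
      determines the whole tuple. This bounds the size of the group by \<open>m k'\<close> and makes
      the regions \<open>D w\<close> disjoint.\<close>
    have inj: "inj_on (\<lambda>w. w k') ?F"
    proof (rule inj_onI, rule ext)
      fix w w' l assume "w \<in> ?F" "w' \<in> ?F" "w k' = w' k'"
      then show "w l = w' l" using UNIV by (cases "l = k") auto
    qed
    have "card ?F \<le> m k'"
      using card_inj_on_le[OF inj, of "{..<m k'}"] Mlt by auto
    moreover have "?T \<le> (\<Sum>w\<in>?F. 1)" by (intro sum_mono q01)
    ultimately have T1: "?T \<le> m k'" by simp
    have T0: "0 \<le> ?T" by (intro sum_nonneg q01)
    have "?T = (\<Sum>w\<in>{w \<in> ?F. good w}. c1 w * c2 w * c3 w)"
      unfolding q_def using fM by (intro sum.inter_filter[symmetric]) simp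
    also have "\<dots> = (\<Sum>w\<in>{w \<in> ?F. good w}. measure (cgauss_vec n 1 (u1 w)) (A1 c) *
        measure (cgauss_vec n 1 (u2 w)) (A2 c) *
        measure (cgauss_vec n 1 (\<lambda>t. a * u1 w t + b * u2 w t)) (D w))"
      by (simp add: c1_def c2_def c3_def)
    \<comment> \<open>The reference variance is \<open>P\<close>, so the energy bound contributes
      only a factor exponential in \<open>n\<close> whose base does not depend on
      \<open>P\<close>.\<close>
    also have "\<dots> \<le> (P\<^sup>2 * \<tau>) ^ n * exp (2 * (hh * (4 * n * P)) / P) * (?\<nu>1 * ?\<nu>2)"
    proof (rule sum_measure_cgauss_vec_le[OF P \<tau>])
      show "finite {w \<in> ?F. good w}" using fM by simp
      show "A1 c \<in> sets (lborels n)" "A2 c \<in> sets (lborels n)" "\<And>w. D w \<in> sets (lborels n)"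
        by (simp_all add: A1_def A2_def D_def meas)
      show "disjoint_family_on D {w \<in> ?F. good w}"
        using inj by (auto simp: disjoint_family_on_def D_def inj_on_def)
      fix w assume "w \<in> {w \<in> ?F. good w}"
      then have "p w \<le> 4 * n * P" by (simp add: good_def)
      have "(\<Sum>t<n. (cmod (u1 w t))\<^sup>2 + (cmod (u2 w t))\<^sup>2) \<le> (\<Sum>t<n. hh * (norm (enc w t))\<^sup>2)"
        unfolding hh_def distrib_right u1_def u2_def by (intro sum_mono add_mono cmod_row_times_column_le)
      also have "\<dots> = hh * p w" by (simp add: p_def sum_distrib_left)
      also have "\<dots> \<le> hh * (4 * n * P)"
        using \<open>p w \<le> 4 * n * P\<close> by (intro mult_left_mono) (auto simp: hh_def)
      finally show "(\<Sum>t<n. (cmod (u1 w t))\<^sup>2 + (cmod (u2 w t))\<^sup>2) \<le> hh * (4 * n * P)" .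
    qed
    also have "(P\<^sup>2 * \<tau>) ^ n * exp (2 * (hh * (4 * n * P)) / P) = L"
    proof -
      have "2 * (hh * (4 * n * P)) / P = n * (8 * hh)" using P by simp
      then show ?thesis by (simp add: L_def power_mult_distrib exp_of_nat_mult)
    qed
    finally have T2: "?T \<le> L * (?\<nu>1 * ?\<nu>2)" .
    \<comment> \<open>The counting bound and the measure bound are combined by their geometric mean.
      The square root of the two Gaussian masses is then at most their arithmetic mean, which can be
      summed over \<open>c\<close> because the regions \<open>A1 c\<close>, and likewise
      \<open>A2 c\<close>, are disjoint.\<close>
    have "?T * ?T \<le> m k' * (L * (?\<nu>1 * ?\<nu>2))"
      using T0 T1 T2 by (intro mult_mono) auto
    then have "?T \<le> sqrt (m k' * (L * (?\<nu>1 * ?\<nu>2)))"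
      by (intro real_le_rsqrt) (simp add: power2_eq_square)
    also have "\<dots> = sqrt (m k' * L) * sqrt (?\<nu>1 * ?\<nu>2)"
      by (simp add: real_sqrt_mult)
    also have "\<dots> \<le> sqrt (m k' * L) * ((?\<nu>1 + ?\<nu>2) / 2)"
      using L by (intro mult_left_mono arith_geo_mean_sqrt) auto
    finally show "?T \<le> sqrt (m k' * L) * ((?\<nu>1 + ?\<nu>2) / 2)" .
  qed
  also have "\<dots> = sqrt (m k' * L) * (((\<Sum>c<m k. measure (cgauss_vec n P (\<lambda>_. 0)) (A1 c))
      + (\<Sum>c<m k. measure (cgauss_vec n P (\<lambda>_. 0)) (A2 c))) / 2)"
    by (simp add: sum_distrib_left[symmetric] sum.distrib sum_divide_distrib[symmetric])
  also have "\<dots> \<le> sqrt (m k' * L) * ((1 + 1) / 2)"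
  proof -
    interpret \<nu>: prob_space "cgauss_vec n P (\<lambda>_. 0)" using P by (intro prob_space_cgauss_vec) simp
    have "(\<Sum>c<m k. \<nu>.prob (A1 c)) \<le> 1" "(\<Sum>c<m k. \<nu>.prob (A2 c)) \<le> 1"
      by (subst \<nu>.finite_measure_finite_Union[symmetric];
          auto simp: A1_def A2_def meas disjoint_family_on_def)+
    then show ?thesis using L by (intro mult_left_mono divide_right_mono add_mono) auto
  qed
  finally have "m k * m k' / 2 \<le> sqrt (m k' * L)" by (simp add: cM)
  then have "(m k * m k' / 2)\<^sup>2 \<le> m k' * L"
    using L power_mono[of "m k * m k' / 2" "sqrt (m k' * L)" 2] by simp
  then have "(real (m k))\<^sup>2 * m k' * m k' \<le> 4 * L * m k'"
    by (simp add: power2_eq_square algebra_simps)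
  then have "(real (m k))\<^sup>2 * m k' \<le> 4 * L"
    using m[of k'] by (simp add: mult_le_cancel_right)
  moreover have "(2 powr (real n * R k))\<^sup>2 * 2 powr (real n * R k') \<le> (real (m k))\<^sup>2 * m k'"
    using m by (intro mult_mono power_mono) auto
  ultimately show ?thesis by (simp add: L_def hh_def)
qed

text \<open>Take the logarithm of the bound for a single code with error at most 1/12 and divide by
  \<open>n\<close>. The constant depends only on the states and on \<open>a\<close>,
  \<open>b\<close>; the factor 4 costs 2 bits, which is at most \<open>2 * n\<close>.\<close>

lemma rate_tradeoff:
  fixes H :: "('m::finite, 'j::finite, 'k::finite) channel_states" and j0 j1 j2 :: 'j
  assumes UNIV: "(UNIV :: 'k set) = {k, k'}" and kk': "k \<noteq> k'"
    and ab: "\<And>i. H $ k' $ j0 $ i = a * H $ k $ j1 $ i + b * H $ k $ j2 $ i"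
  shows "\<exists>C. \<forall>P\<ge>4. \<forall>R. achievable H P R \<longrightarrow> 2 * R k + R k' \<le> 2 * log 2 P + C"
proof -
  define \<tau> where "\<tau> = 6 * (1 + (cmod a)\<^sup>2 + (cmod b)\<^sup>2)"
  define c where "c = \<tau> * exp (8 * ((norm (H $ k $ j1))\<^sup>2 + (norm (H $ k $ j2))\<^sup>2))"
  have \<tau>: "6 \<le> \<tau>" "6 * (cmod a)\<^sup>2 \<le> \<tau>" "6 * (cmod b)\<^sup>2 \<le> \<tau>" by (simp_all add: \<tau>_def)
  have c: "0 < c" using \<tau> by (simp add: c_def)
  have "2 * R k + R k' \<le> 2 * log 2 P + (log 2 c + 2)"
    if P: "4 \<le> P" and ach: "achievable H P R" for P R
  proof -
    have "\<forall>\<^sub>F n in sequentially. 0 < n \<and> (\<exists>enc dec.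
        (\<forall>s k. dec s k \<in> PiM {..<n} (\<lambda>_. borel) \<rightarrow>\<^sub>M count_space UNIV) \<and>
        average_power n R enc \<le> P \<and> (\<forall>s k. error_probability H n R enc dec s k \<le> 1 / 12))"
      using ach unfolding achievable_def
      by (intro eventually_conj eventually_gt_at_top) (auto dest: spec[of _ "1 / 12 :: real"])
    from eventually_happens'[OF sequentially_bot this] obtain n enc dec where n: "0 < n"
      and dec: "\<And>s k. dec s k \<in> PiM {..<n} (\<lambda>_. borel) \<rightarrow>\<^sub>M count_space UNIV"
      and pow: "average_power n R enc \<le> P"
      and err: "\<And>s k. error_probability H n R enc dec s k \<le> 1 / 12"
      by blast
    have "2 powr (n * (2 * R k + R k')) = (2 powr (real n * R k))\<^sup>2 * 2 powr (real n * R k')"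
      by (simp add: powr_add[symmetric] power2_eq_square algebra_simps)
    also have "\<dots> \<le> 4 * (P\<^sup>2 * c) ^ n"
      using rate_tradeoff_code[OF UNIV kk' ab \<tau> P n dec pow err] by (simp add: c_def mult.assoc)
    finally have "log 2 (2 powr (n * (2 * R k + R k'))) \<le> log 2 (4 * (P\<^sup>2 * c) ^ n)"
      using c P by (subst log_le_cancel_iff) auto
    also have "log 2 (4 * (P\<^sup>2 * c) ^ n) = log 2 (2\<^sup>2) + n * (log 2 (P\<^sup>2) + log 2 c)"
      using c P by (subst log_mult) (auto simp: log_nat_power log_mult)
    also have "\<dots> = 2 + n * (2 * log 2 P + log 2 c)"
      using P log_nat_power[of 2 2 2] by (simp add: log_nat_power)
    also have "\<dots> \<le> n * 2 + n * (2 * log 2 P + log 2 c)" using n by simp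
    finally have "n * (2 * R k + R k') \<le> n * (2 * log 2 P + (log 2 c + 2))"
      by (simp add: algebra_simps)
    then show ?thesis using n by simp
  qed
  then show ?thesis by blast
qed

section \<open>Codes and noise\<close>

text \<open>A word close to \<open>x\<close> is determined by the set of disagreeing positions, with
  at most \<open>2 ^ N\<close> choices, and its fewer than \<open>D\<close> values there.\<close>

lemma card_hamming_ball_le:
  fixes S :: "'a set"
  assumes S: "finite S" "S \<noteq> {}" and x: "x \<in> (\<Pi>\<^sub>E b\<in>{..<N}. S)"
  shows "card {y \<in> (\<Pi>\<^sub>E b\<in>{..<N}. S). card {b \<in> {..<N}. x b \<noteq> y b} < D} \<le> 2 ^ N * card S ^ D"
proof -
  define \<B> where "\<B> = {B \<in> Pow {..<N}. card B < D}"
  define Y where "Y B = (\<Pi>\<^sub>E b\<in>{..<N}. if b \<in> B then S else {x b})" for B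
  have fin: "finite \<B>" by (simp add: \<B>_def)
  have finY: "finite (Y B)" for B unfolding Y_def using S by (intro finite_PiE) auto
  have cardS: "1 \<le> card S" using S by (simp add: Suc_leI card_gt_0_iff)
  have "{y \<in> (\<Pi>\<^sub>E b\<in>{..<N}. S). card {b \<in> {..<N}. x b \<noteq> y b} < D} \<subseteq> (\<Union>B\<in>\<B>. Y B)"
  proof
    fix y assume y: "y \<in> {y \<in> (\<Pi>\<^sub>E b\<in>{..<N}. S). card {b \<in> {..<N}. x b \<noteq> y b} < D}"
    then have "{b \<in> {..<N}. x b \<noteq> y b} \<in> \<B>" by (auto simp: \<B>_def)
    moreover have "y \<in> Y {b \<in> {..<N}. x b \<noteq> y b}"
      using y by (auto simp: Y_def PiE_iff)
    ultimately show "y \<in> (\<Union>B\<in>\<B>. Y B)" by blast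
  qed
  then have "card {y \<in> (\<Pi>\<^sub>E b\<in>{..<N}. S). card {b \<in> {..<N}. x b \<noteq> y b} < D} \<le> card (\<Union>B\<in>\<B>. Y B)"
    using fin finY by (intro card_mono) auto
  also have "\<dots> \<le> (\<Sum>B\<in>\<B>. card (Y B))" using fin by (rule card_UN_le)
  also have "\<dots> \<le> (\<Sum>B\<in>\<B>. card S ^ D)"
  proof (intro sum_mono)
    fix B assume B: "B \<in> \<B>"
    have "card (Y B) = (\<Prod>b<N. if b \<in> B then card S else 1)"
      unfolding Y_def by (subst card_PiE) (auto intro!: prod.cong)
    also have "\<dots> = card S ^ card B"
      using B by (simp add: \<B>_def prod.If_cases Int_absorb1)
    also have "\<dots> \<le> card S ^ D" using B cardS by (intro power_increasing) (auto simp: \<B>_def)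
    finally show "card (Y B) \<le> card S ^ D" .
  qed
  also have "\<dots> = card \<B> * card S ^ D" by simp
  also have "\<dots> \<le> card (Pow {..<N}) * card S ^ D"
    by (intro mult_right_mono card_mono) (auto simp: \<B>_def)
  finally show ?thesis by (simp add: card_Pow)
qed

text \<open>Greedy choice: the balls around fewer than \<open>m\<close> chosen words cannot cover
  all words, so another word at distance at least \<open>D\<close> from all of them remains.\<close>

lemma gilbert_varshamov:
  fixes S :: "'a set"
  assumes S: "finite S" "S \<noteq> {}" and m: "m * (2 ^ N * card S ^ D) \<le> card S ^ N"
  obtains c where "\<And>i. i < m \<Longrightarrow> c i \<in> (\<Pi>\<^sub>E b\<in>{..<N}. S)"
    and "\<And>i j. i < m \<Longrightarrow> j < m \<Longrightarrow> i \<noteq> j \<Longrightarrow> D \<le> card {b \<in> {..<N}. c i b \<noteq> c j b}"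
proof -
  let ?X = "\<Pi>\<^sub>E b\<in>{..<N}. S"
  let ?far = "\<lambda>x y. D \<le> card {b \<in> {..<N}. x b \<noteq> y b}"
  have sym: "?far x y \<longleftrightarrow> ?far y x" for x y :: "nat \<Rightarrow> 'a" by (simp add: eq_commute)
  have cardS: "0 < card S" using S by (simp add: card_gt_0_iff)
  have finX: "finite ?X" using S by (intro finite_PiE) auto
  have cardX: "card ?X = card S ^ N" by (simp add: card_PiE)
  have "\<exists>c. (\<forall>i<l. c i \<in> ?X) \<and> (\<forall>i<l. \<forall>j<l. i \<noteq> j \<longrightarrow> ?far (c i) (c j))" if "l \<le> m" for l
    using that
  proof (induction l)
    case (Suc l)
    then obtain c where c: "\<forall>i<l. c i \<in> ?X" "\<forall>i<l. \<forall>j<l. i \<noteq> j \<longrightarrow> ?far (c i) (c j)" by auto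
    let ?near = "\<Union>i<l. {y \<in> ?X. \<not> ?far (c i) y}"
    have "card ?near \<le> (\<Sum>i<l. card {y \<in> ?X. \<not> ?far (c i) y})" by (rule card_UN_le) simp
    also have "\<dots> \<le> (\<Sum>i<l. 2 ^ N * card S ^ D)"
      using c card_hamming_ball_le[OF S] by (intro sum_mono) (simp add: not_le)
    also have "\<dots> < m * (2 ^ N * card S ^ D)"
      using Suc.prems cardS by simp
    finally have less: "card ?near < card ?X" using m cardX by simp
    have finnear: "finite ?near" by (rule finite_subset[OF _ finX]) auto
    have "\<not> ?X \<subseteq> ?near"
    proof
      assume "?X \<subseteq> ?near"
      from card_mono[OF finnear this] less show False by linarith
    qed
    then obtain y where y: "y \<in> ?X" "y \<notin> ?near" by blast
    have "(\<forall>i<Suc l. (c(l := y)) i \<in> ?X) \<and>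
      (\<forall>i<Suc l. \<forall>j<Suc l. i \<noteq> j \<longrightarrow> ?far ((c(l := y)) i) ((c(l := y)) j))"
      using c y sym[of y] by (auto simp: less_Suc_eq)
    then show ?case by blast
  qed simp
  from this[OF order_refl] obtain c
    where c: "\<forall>i<m. c i \<in> ?X" "\<forall>i<m. \<forall>j<m. i \<noteq> j \<longrightarrow> ?far (c i) (c j)" by (elim exE conjE)
  show ?thesis using c by (intro that[of c]) simp_all
qed

section \<open>Large noise samples\<close>

lemma prob_space_complex_gaussian: "prob_space complex_gaussian"
  unfolding complex_gaussian_eq by (rule prob_space_cgauss) simp

lemma sets_complex_gaussian [simp, measurable_cong]: "sets complex_gaussian = sets borel"
  by (simp add: complex_gaussian_def)

lemma space_complex_gaussian [simp]: "space complex_gaussian = UNIV"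
  by (simp add: complex_gaussian_def)

text \<open>Continuity from above along the decreasing sets \<open>i < cmod z\<close>, whose
  intersection is empty.\<close>

lemma complex_gaussian_tail:
  assumes "0 < \<delta>"
  obtains r where "0 < r" "measure complex_gaussian {z. r < cmod z} \<le> \<delta>"
proof -
  interpret prob_space complex_gaussian by (rule prob_space_complex_gaussian)
  have "(\<lambda>i. prob {z. real i < cmod z}) \<longlonglongrightarrow> prob (\<Inter>i. {z. real i < cmod z})"
    by (intro finite_Lim_measure_decseq) (auto simp: decseq_def)
  also have "(\<Inter>i. {z. real i < cmod z}) = {}"
    by (auto simp: not_less) (metis less_asym reals_Archimedean2)
  finally have "(\<lambda>i. prob {z. real i < cmod z}) \<longlonglongrightarrow> 0" by simp
  from order_tendstoD(2)[OF this assms]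
  have "\<forall>\<^sub>F i in sequentially. 0 < i \<and> prob {z. real i < cmod z} < \<delta>"
    by (intro eventually_conj eventually_gt_at_top) auto
  from eventually_happens'[OF sequentially_bot this]
  obtain i where "0 < i" "prob {z. real i < cmod z} < \<delta>" by blast
  then show ?thesis by (intro that[of "real i"]) auto
qed

text \<open>Union bound over the sets \<open>B\<close> of \<open>k\<close> positions, at most
  \<open>2 ^ n\<close> in number; by independence each has the \<open>k\<close>-th power of the tail
  probability.\<close>

lemma measure_noise_many_large_le:
  assumes A: "A \<subseteq> {z \<in> space (noise n). k \<le> card {t \<in> {..<n}. r < cmod (z t)}}"
  shows "measure (noise n) A \<le> 2 ^ n * measure complex_gaussian {z. r < cmod z} ^ k"
proof -
  interpret G: prob_space complex_gaussian by (rule prob_space_complex_gaussian)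
  interpret N: product_prob_space "\<lambda>_::nat. complex_gaussian" by standard
  interpret P: prob_space "noise n"
    unfolding noise_def by (intro prob_space_PiM prob_space_complex_gaussian)
  let ?p = "G.prob {z. r < cmod z}"
  define \<B> where "\<B> = {B \<in> Pow {..<n}. card B = k}"
  define E where "E B = (\<Pi>\<^sub>E t\<in>{..<n}. if t \<in> B then {z. r < cmod z} else UNIV)" for B
  have fin: "finite \<B>" by (simp add: \<B>_def)
  have E: "E B \<in> sets (noise n)" for B
    unfolding E_def noise_def by (intro sets_PiM_I_finite) auto
  have prob: "P.prob (E B) = ?p ^ k" if "B \<in> \<B>" for B
  proof -
    have "emeasure (noise n) (E B) = (\<Prod>t<n. emeasure complex_gaussian (if t \<in> B then {z. r < cmod z} else UNIV))"
      unfolding E_def noise_def by (intro N.emeasure_PiM) auto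
    also have "\<dots> = (\<Prod>t<n. ennreal (if t \<in> B then ?p else 1))"
      using G.emeasure_space_1 by (intro prod.cong) (auto simp: G.emeasure_eq_measure)
    also have "\<dots> = ennreal (?p ^ k)"
      using that by (subst prod_ennreal) (auto simp: \<B>_def prod.If_cases Int_absorb1)
    finally show ?thesis by (simp add: measure_def)
  qed
  have "A \<subseteq> (\<Union>B\<in>\<B>. E B)"
  proof
    fix z assume "z \<in> A"
    then have z: "z \<in> {z \<in> space (noise n). k \<le> card {t \<in> {..<n}. r < cmod (z t)}}" using A by blast
    then obtain B where "B \<subseteq> {t \<in> {..<n}. r < cmod (z t)}" "card B = k"
      by (metis (lifting) mem_Collect_eq obtain_subset_with_card_n)
    then have "B \<in> \<B>" "z \<in> E B"
      using z by (auto simp: \<B>_def E_def noise_def space_PiM PiE_iff)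
    then show "z \<in> (\<Union>B\<in>\<B>. E B)" by blast
  qed
  then have "P.prob A \<le> P.prob (\<Union>B\<in>\<B>. E B)"
    using fin E by (intro P.finite_measure_mono) auto
  also have "\<dots> \<le> (\<Sum>B\<in>\<B>. P.prob (E B))"
    using fin E by (intro P.finite_measure_subadditive_finite) auto
  also have "\<dots> = card \<B> * ?p ^ k" by (simp add: prob)
  also have "\<dots> \<le> 2 ^ n * ?p ^ k"
  proof -
    have "card \<B> \<le> card (Pow {..<n})" by (intro card_mono) (auto simp: \<B>_def)
    also have "\<dots> = 2 ^ n" by (simp add: card_Pow)
    finally have "real (card \<B>) \<le> real (2 ^ n)" by (rule of_nat_mono)
    then show ?thesis by (intro mult_right_mono) auto
  qed
  finally show ?thesis .
qed

section \<open>Interference alignment\<close>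

definition other :: "2 \<Rightarrow> 2" where
  "other l = (if l = 1 then 2 else 1)"

lemma other: "other l \<noteq> l" "(UNIV :: 2 set) = {l, other l}"
  using exhaust_2[of l] by (auto simp: other_def UNIV_2)

text \<open>
  A block consists of three channel uses. The signal space of the first user is spanned over the
  reals by \<open>(1, 0, 0)\<close> and \<open>(0, 1, 0)\<close>, that of the second user by \<open>(-1, 0, 1)\<close> and \<open>(0, -1, \<i>)\<close>:
  either real plane meets the complex span of the other one only in 0.
\<close>

definition block_signal :: "bool \<Rightarrow> nat \<Rightarrow> complex \<Rightarrow> complex \<Rightarrow> complex" where
  "block_signal first t x y =
     (if first then (if t = 0 then x else if t = 1 then y else 0)
      else (if t = 0 then - x else if t = 1 then - y else x + \<i> * y))"

lemma block_signal_linear: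
  "block_signal F t (a * x + b * x') (a * y + b * y') = a * block_signal F t x y + b * block_signal F t x' y'"
  by (simp add: block_signal_def algebra_simps)

text \<open>
  The estimate removes interference from the real plane of the other user, scaled by \<open>c\<close>. For
  \<open>c = 0\<close> the divisions yield 0, which is what is needed.
\<close>

definition block_estimate :: "bool \<Rightarrow> complex \<Rightarrow> (nat \<Rightarrow> complex) \<Rightarrow> complex \<times> complex" where
  "block_estimate first c y =
     (if first then (y 0 + c * Re (y 2 / c), y 1 + c * Im (y 2 / c))
      else (let v = (y 0 + \<i> * y 1 + y 2) / c in (- y 0 + c * Re v, - y 1 + c * Im v)))"

text \<open>Dividing by \<open>c\<close> turns the perturbation into \<open>w / c\<close>, whose
  real and imaginary parts have modulus at most \<open>cmod (w / c)\<close>; multiplying by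
  \<open>c\<close> restores \<open>cmod w\<close>.\<close>

lemma residual_interference:
  fixes c w :: complex and v1 v2 :: real
  shows "cmod (c * Re ((c * (v1 + \<i> * v2) + w) / c) - c * v1) \<le> cmod w"
    and "cmod (c * Im ((c * (v1 + \<i> * v2) + w) / c) - c * v2) \<le> cmod w"
proof -
  have "cmod (c * Re ((c * (v1 + \<i> * v2) + w) / c) - c * v1) \<le> cmod w \<and>
    cmod (c * Im ((c * (v1 + \<i> * v2) + w) / c) - c * v2) \<le> cmod w"
  proof (cases "c = 0")
    case False
    have le: "cmod (c * of_real x) \<le> cmod w" if "\<bar>x\<bar> \<le> cmod (w / c)" for x :: real
      using that False by (simp add: norm_mult norm_divide field_simps)
    have "(c * (v1 + \<i> * v2) + w) / c = (v1 + \<i> * v2) + w / c"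
      using False by (simp add: field_simps)
    then show ?thesis
      using le[OF abs_Re_le_cmod] le[OF abs_Im_le_cmod] by (simp add: algebra_simps)
  qed simp
  then show "cmod (c * Re ((c * (v1 + \<i> * v2) + w) / c) - c * v1) \<le> cmod w"
    and "cmod (c * Im ((c * (v1 + \<i> * v2) + w) / c) - c * v2) \<le> cmod w" by auto
qed

text \<open>For the first user slot 2 carries interference only. For the second,
  \<open>y 0 + \<i> * y 1 + y 2\<close> cancels the desired signal. In both cases
  \<open>c * (v1 + \<i> * v2)\<close> plus noise of modulus at most \<open>3 * r\<close> is left,
  and since \<open>v1\<close>, \<open>v2\<close> are real they are read off separately. The noise of
  the slot itself adds \<open>r\<close>.\<close>

lemma block_estimate_error:
  fixes c :: complex and v1 v2 :: real
  assumes y: "\<And>t. t < 3 \<Longrightarrow> y t = block_signal F t x1 x2 + c * block_signal (\<not> F) t v1 v2 + z t"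
    and z: "\<And>t. t < 3 \<Longrightarrow> cmod (z t) \<le> r"
  shows "cmod (fst (block_estimate F c y) - x1) \<le> 4 * r"
    and "cmod (snd (block_estimate F c y) - x2) \<le> 4 * r"
proof -
  have yt: "y 0 = block_signal F 0 x1 x2 + c * block_signal (\<not> F) 0 v1 v2 + z 0"
    "y 1 = block_signal F 1 x1 x2 + c * block_signal (\<not> F) 1 v1 v2 + z 1"
    "y 2 = block_signal F 2 x1 x2 + c * block_signal (\<not> F) 2 v1 v2 + z 2"
    by (rule y; simp)+
  have zt: "cmod (z 0) \<le> r" "cmod (z 1) \<le> r" "cmod (z 2) \<le> r" by (rule z; simp)+
  have tri: "cmod (a + b) \<le> 4 * r" if "cmod a \<le> r" "cmod b \<le> 3 * r" for a b
    using norm_triangle_ineq[of a b] that by linarith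
  have tri': "cmod (b - a) \<le> 4 * r" if "cmod a \<le> r" "cmod b \<le> 3 * r" for a b
    using tri[of "- a" b] that by simp
  have res: "cmod (c * Re ((c * (v1 + \<i> * v2) + w) / c) - c * v1) \<le> cmod w"
    "cmod (c * Im ((c * (v1 + \<i> * v2) + w) / c) - c * v2) \<le> cmod w" for w
    by (rule residual_interference)+
  have "cmod (fst (block_estimate F c y) - x1) \<le> 4 * r \<and> cmod (snd (block_estimate F c y) - x2) \<le> 4 * r"
  proof (cases F)
    case True
    have y2: "y 2 = c * (v1 + \<i> * v2) + z 2" using True yt(3) by (simp add: block_signal_def)
    have w: "cmod (z 2) \<le> 3 * r" using zt norm_ge_zero[of "z 2"] by linarith
    have "fst (block_estimate F c y) - x1 = z 0 + (c * Re ((c * (v1 + \<i> * v2) + z 2) / c) - c * v1)"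
      "snd (block_estimate F c y) - x2 = z 1 + (c * Im ((c * (v1 + \<i> * v2) + z 2) / c) - c * v2)"
      using True yt(1,2) unfolding block_estimate_def y2 by (simp_all add: block_signal_def)
    then show ?thesis
      using zt w res[of "z 2"]
      by (auto intro!: tri intro: order_trans)
  next
    case False
    define w where "w = z 0 + \<i> * z 1 + z 2"
    have y2: "y 0 + \<i> * y 1 + y 2 = c * (v1 + \<i> * v2) + w"
      unfolding yt using False by (simp add: block_signal_def w_def algebra_simps)
    have w: "cmod w \<le> 3 * r"
      using zt norm_triangle_ineq[of "z 0 + \<i> * z 1" "z 2"] norm_triangle_ineq[of "z 0" "\<i> * z 1"]
      by (simp add: w_def norm_mult)
    have "fst (block_estimate F c y) - x1 = (c * Re ((c * (v1 + \<i> * v2) + w) / c) - c * v1) - z 0"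
      "snd (block_estimate F c y) - x2 = (c * Im ((c * (v1 + \<i> * v2) + w) / c) - c * v2) - z 1"
      using False yt(1,2) unfolding block_estimate_def y2 by (simp_all add: block_signal_def Let_def)
    then show ?thesis
      using zt w res[of "w"]
      by (auto intro!: tri' intro: order_trans)
  qed
  then show "cmod (fst (block_estimate F c y) - x1) \<le> 4 * r"
    and "cmod (snd (block_estimate F c y) - x2) \<le> 4 * r" by auto
qed

text \<open>
  Signals for one user are sent along beams designed from the states \<open>h\<close> of the other user: the
  first beam is invisible in state 2, the second one in state 1, and both have the same gain in
  state 3. Hence in each state the two real planes of interference coincide.
\<close>

definition beam1 :: "complex ^ 2 ^ 3 \<Rightarrow> complex ^ 2" where
  "beam1 h = (\<chi> i. det2 (h $ 3) (h $ 1) * (if i = 1 then h $ 2 $ 2 else - (h $ 2 $ 1)))"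

definition beam2 :: "complex ^ 2 ^ 3 \<Rightarrow> complex ^ 2" where
  "beam2 h = (\<chi> i. det2 (h $ 3) (h $ 2) * (if i = 1 then h $ 1 $ 2 else - (h $ 1 $ 1)))"

definition gain1 :: "complex ^ 2 ^ 3 \<Rightarrow> complex ^ 2 \<Rightarrow> complex" where
  "gain1 h g = det2 (h $ 3) (h $ 1) * det2 g (h $ 2)"

definition gain2 :: "complex ^ 2 ^ 3 \<Rightarrow> complex ^ 2 \<Rightarrow> complex" where
  "gain2 h g = det2 (h $ 3) (h $ 2) * det2 g (h $ 1)"

lemma beam_gain:
  "(\<Sum>i\<in>UNIV. g $ i * beam1 h $ i) = gain1 h g"
  "(\<Sum>i\<in>UNIV. g $ i * beam2 h $ i) = gain2 h g"
  by (simp_all add: sum_2 beam1_def beam2_def gain1_def gain2_def det2_def algebra_simps)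

text \<open>\<open>gain1\<close> vanishes in state 2, and in state 3 it is the common gain; hence
  the case distinction.\<close>

definition interference_gain :: "complex ^ 2 ^ 3 \<Rightarrow> 3 \<Rightarrow> complex" where
  "interference_gain h j = (if j = 2 then gain2 h (h $ 2) else gain1 h (h $ j))"

text \<open>In states 1 and 2 only one of the two symbol pairs survives; in state 3 the gains agree
  and the pairs add. The same \<open>v1\<close>, \<open>v2\<close> serve all slots, so the
  interference is one real plane scaled by one complex number.\<close>

lemma interference_aligned:
  fixes a1 a2 b1 b2 :: real
  obtains v1 v2 :: real where
    "\<And>F t. gain1 h (h $ j) * block_signal F t a1 a2 + gain2 h (h $ j) * block_signal F t b1 b2
      = interference_gain h j * block_signal F t v1 v2"
proof -
  consider "j = 1" | "j = 2" | "j = 3" using exhaust_3 by blast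
  then show ?thesis
  proof cases
    case 1
    then show ?thesis
      by (intro that[of a1 a2]) (simp add: interference_gain_def gain1_def gain2_def det2_def)
  next
    case 2
    then show ?thesis
      by (intro that[of b1 b2]) (simp add: interference_gain_def gain1_def gain2_def det2_def)
  next
    case 3
    have "block_signal F t (a1 + b1) (a2 + b2) = block_signal F t a1 a2 + block_signal F t b1 b2" for F t
      using block_signal_linear[of F t 1 a1 1 b1 a2 b2] by simp
    then show ?thesis
      using 3 by (intro that[of "a1 + b1" "a2 + b2"])
        (simp add: interference_gain_def gain1_def gain2_def algebra_simps)
  qed
qed

text \<open>The four data symbols of user \<open>l\<close> in a block are \<open>\<sigma> l 0, \<dots>, \<sigma> l 3\<close>, and \<open>d\<close> is their spacing.\<close>

definition block_input :: "(2, 3, 2) channel_states \<Rightarrow> real \<Rightarrow> (2 \<Rightarrow> nat \<Rightarrow> nat) \<Rightarrow> nat \<Rightarrow> complex ^ 2" where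
  "block_input H d \<sigma> t = (\<chi> i. \<Sum>l\<in>UNIV.
     block_signal (l = 1) t (of_real (d * \<sigma> l 0)) (of_real (d * \<sigma> l 1)) * beam1 (H $ other l) $ i +
     block_signal (l = 1) t (of_real (d * \<sigma> l 2)) (of_real (d * \<sigma> l 3)) * beam2 (H $ other l) $ i)"

text \<open>Symbols 0 and 2 share the first coordinate of the signal plane, symbols 1 and 3 the
  second. The tolerance is the error bound of \<open>block_estimate_error\<close>.\<close>

definition consistent ::
  "(2, 3, 2) channel_states \<Rightarrow> real \<Rightarrow> real \<Rightarrow> 2 \<Rightarrow> 3 \<Rightarrow> (nat \<Rightarrow> complex) \<Rightarrow> (nat \<Rightarrow> nat) \<Rightarrow> bool" where
  "consistent H d r l j y s \<longleftrightarrow>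
    (let e = block_estimate (l = 1) (interference_gain (H $ l) j) y;
         \<gamma>1 = gain1 (H $ other l) (H $ l $ j);
         \<gamma>2 = gain2 (H $ other l) (H $ l $ j)
     in cmod (fst e - of_real d * (\<gamma>1 * of_nat (s 0) + \<gamma>2 * of_nat (s 2))) \<le> 4 * r \<and>
        cmod (snd e - of_real d * (\<gamma>1 * of_nat (s 1) + \<gamma>2 * of_nat (s 3))) \<le> 4 * r)"

text \<open>The received block splits into the user's own symbols with gains \<open>gain1\<close>,
  \<open>gain2\<close> and the aligned interference, which is the form handled by
  \<open>block_estimate_error\<close>.\<close>

lemma consistent_transmitted:
  assumes y: "\<And>t. t < 3 \<Longrightarrow> y t = (\<Sum>i\<in>UNIV. H $ l $ j $ i * block_input H d \<sigma> t $ i) + z t"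
    and z: "\<And>t. t < 3 \<Longrightarrow> cmod (z t) \<le> r"
  shows "consistent H d r l j y (\<sigma> l)"
proof -
  let ?g = "H $ l $ j" and ?l = "other l"
  let ?\<gamma>1 = "gain1 (H $ ?l) ?g" and ?\<gamma>2 = "gain2 (H $ ?l) ?g"
  have oth: "other ?l = l" "(?l = 1) = (\<not> (l = 1))"
    using exhaust_2[of l] by (auto simp: other_def)
  have UN: "sum f UNIV = f l + f ?l" for f :: "2 \<Rightarrow> complex"
    using other[of l] by (metis (no_types, lifting) finite.emptyI finite.insertI insert_absorb
      insert_not_empty singletonD sum.empty sum.insert add.right_neutral)
  let ?s = "\<lambda>F t l k. block_signal F t (of_real (d * \<sigma> l k)) (of_real (d * \<sigma> l (Suc k)))"
  obtain v1 v2 :: real where v: "\<And>F t. gain1 (H $ l) ?g * ?s F t ?l 0 + gain2 (H $ l) ?g * ?s F t ?l 2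
      = interference_gain (H $ l) j * block_signal F t v1 v2"
        using interference_aligned[of "H $ l" j "d * \<sigma> ?l 0" "d * \<sigma> ?l (Suc 0)" "d * \<sigma> ?l 2" "d * \<sigma> ?l (Suc 2)"]
    by blast
  have "y t = block_signal (l = 1) t (d * (?\<gamma>1 * \<sigma> l 0 + ?\<gamma>2 * \<sigma> l 2)) (d * (?\<gamma>1 * \<sigma> l 1 + ?\<gamma>2 * \<sigma> l 3))
      + interference_gain (H $ l) j * block_signal (\<not> (l = 1)) t v1 v2 + z t" if "t < 3" for t
  proof -
    have "(\<Sum>i\<in>UNIV. ?g $ i * block_input H d \<sigma> t $ i)
      = (\<Sum>m\<in>UNIV. ?s (m = 1) t m 0 * gain1 (H $ other m) ?g + ?s (m = 1) t m 2 * gain2 (H $ other m) ?g)"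
      unfolding beam_gain[symmetric] block_input_def
      by (simp add: sum_2 numeral_2_eq_2 numeral_3_eq_3 algebra_simps)
    also have "\<dots> = (?\<gamma>1 * ?s (l = 1) t l 0 + ?\<gamma>2 * ?s (l = 1) t l 2)
      + (gain1 (H $ l) ?g * ?s (?l = 1) t ?l 0 + gain2 (H $ l) ?g * ?s (?l = 1) t ?l 2)"
      by (simp add: UN oth(1) mult.commute)
    also have "\<dots> = (?\<gamma>1 * ?s (l = 1) t l 0 + ?\<gamma>2 * ?s (l = 1) t l 2)
      + interference_gain (H $ l) j * block_signal (\<not> (l = 1)) t v1 v2"
      unfolding v oth(2) ..
    also have "?\<gamma>1 * ?s (l = 1) t l 0 + ?\<gamma>2 * ?s (l = 1) t l 2
      = block_signal (l = 1) t (d * (?\<gamma>1 * \<sigma> l 0 + ?\<gamma>2 * \<sigma> l 2)) (d * (?\<gamma>1 * \<sigma> l 1 + ?\<gamma>2 * \<sigma> l 3))"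
      unfolding block_signal_linear[symmetric] by (simp add: numeral_2_eq_2 numeral_3_eq_3 algebra_simps)
    finally show ?thesis using y[OF that] by simp
  qed
  from block_estimate_error[OF this z] show ?thesis
    unfolding consistent_def Let_def by blast
qed

text \<open>Multiplying by \<open>cnj \<gamma>1\<close> and taking imaginary parts removes
  \<open>p\<close> and leaves \<open>q\<close> times a fixed real number. An integer multiple of a
  real number that is smaller than it in modulus is zero. \<open>cnj \<gamma>2\<close> does the same
  for \<open>p\<close>.\<close>

lemma integer_combination_separated:
  fixes p q :: int
  assumes "cmod (\<gamma>1 * of_int p + \<gamma>2 * of_int q) * (cmod \<gamma>1 + cmod \<gamma>2) < \<bar>Im (\<gamma>2 * cnj \<gamma>1)\<bar>"
  shows "p = 0 \<and> q = 0"
proof -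
  let ?v = "\<gamma>1 * of_int p + \<gamma>2 * of_int q"
  have lt: "cmod (?v * \<gamma>) < \<bar>Im (\<gamma>2 * cnj \<gamma>1)\<bar>" if "cmod \<gamma> \<le> cmod \<gamma>1 + cmod \<gamma>2" for \<gamma>
    using mult_left_mono[OF that, of "cmod ?v"] assms by (simp add: norm_mult)
  have zero: "k = 0" if "\<bar>of_int k * x\<bar> < \<bar>x\<bar>" for k :: int and x :: real
  proof (rule ccontr)
    assume "k \<noteq> 0"
    then have "1 \<le> \<bar>of_int k :: real\<bar>" by linarith
    then have "1 * \<bar>x\<bar> \<le> \<bar>of_int k\<bar> * \<bar>x\<bar>" by (intro mult_right_mono) auto
    with that show False by (simp add: abs_mult)
  qed
  have "Im (?v * cnj \<gamma>1) = of_int q * Im (\<gamma>2 * cnj \<gamma>1)" "Im (?v * cnj \<gamma>2) = - (of_int p * Im (\<gamma>2 * cnj \<gamma>1))"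
    by (simp_all add: algebra_simps)
  then have "\<bar>of_int q * Im (\<gamma>2 * cnj \<gamma>1)\<bar> < \<bar>Im (\<gamma>2 * cnj \<gamma>1)\<bar>" "\<bar>of_int p * Im (\<gamma>2 * cnj \<gamma>1)\<bar> < \<bar>Im (\<gamma>2 * cnj \<gamma>1)\<bar>"
    using lt[of "cnj \<gamma>1"] lt[of "cnj \<gamma>2"] abs_Im_le_cmod[of "?v * cnj \<gamma>1"] abs_Im_le_cmod[of "?v * cnj \<gamma>2"]
    by auto
  then show ?thesis using zero by blast
qed

text \<open>Two grid points within \<open>4 * r\<close> of the same estimate are at most
  \<open>8 * r\<close> apart, so such a spacing forces them to coincide. The spacing depends on
  \<open>H\<close> and \<open>r\<close> but not on the power.\<close>

definition well_spaced :: "(2, 3, 2) channel_states \<Rightarrow> real \<Rightarrow> real \<Rightarrow> bool" where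
  "well_spaced H r d \<longleftrightarrow> 0 < d \<and> (\<forall>l j.
     8 * r * (cmod (gain1 (H $ other l) (H $ l $ j)) + cmod (gain2 (H $ other l) (H $ l $ j)))
     < d * \<bar>Im (gain2 (H $ other l) (H $ l $ j) * cnj (gain1 (H $ other l) (H $ l $ j)))\<bar>)"

lemma ex_well_spaced:
  assumes "generic_states H"
  obtains d where "well_spaced H r d"
proof -
  let ?c = "\<lambda>l j. 8 * r * (cmod (gain1 (H $ other l) (H $ l $ j)) + cmod (gain2 (H $ other l) (H $ l $ j)))"
  let ?I = "\<lambda>l j. \<bar>Im (gain2 (H $ other l) (H $ l $ j) * cnj (gain1 (H $ other l) (H $ l $ j)))\<bar>"
  have I: "0 < ?I l j" for l j
    using assms other(1)[of l] unfolding generic_states_def gain1_def gain2_def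
    by (subst zero_less_abs_iff) blast
  have ev: "\<forall>\<^sub>F d in at_top. ?c l j < d * ?I l j" for l j
    using eventually_gt_at_top[of "?c l j / ?I l j"]
    by eventually_elim (use I[of l j] in \<open>simp only: pos_divide_less_eq\<close>)
  then have "\<forall>\<^sub>F d in at_top. well_spaced H r d"
    unfolding well_spaced_def
    by (intro eventually_conj eventually_gt_at_top eventually_all_finite) auto
  from eventually_happens'[OF trivial_limit_at_top_linorder this] show ?thesis using that by blast
qed

lemma consistent_unique:
  assumes d: "well_spaced H r d"
    and s: "consistent H d r l j y s" and s': "consistent H d r l j y s'"
    and i: "i < 4"
  shows "s i = s' i"
proof -
  let ?\<gamma>1 = "gain1 (H $ other l) (H $ l $ j)" and ?\<gamma>2 = "gain2 (H $ other l) (H $ l $ j)"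
  have d0: "0 < d" using d by (simp add: well_spaced_def)
  have sp: "8 * r * (cmod ?\<gamma>1 + cmod ?\<gamma>2) < d * \<bar>Im (?\<gamma>2 * cnj ?\<gamma>1)\<bar>"
    using d by (simp add: well_spaced_def)
  have eq: "p = p' \<and> q = q'"
    if "cmod (e - of_real d * (?\<gamma>1 * of_nat p + ?\<gamma>2 * of_nat q)) \<le> 4 * r"
      and "cmod (e - of_real d * (?\<gamma>1 * of_nat p' + ?\<gamma>2 * of_nat q')) \<le> 4 * r"
    for e :: complex and p q p' q' :: nat
  proof -
    let ?v = "?\<gamma>1 * of_int (int p - int p') + ?\<gamma>2 * of_int (int q - int q')"
    have "of_real d * ?v = (e - of_real d * (?\<gamma>1 * of_nat p' + ?\<gamma>2 * of_nat q'))
        - (e - of_real d * (?\<gamma>1 * of_nat p + ?\<gamma>2 * of_nat q))"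
      by (simp add: algebra_simps)
    then have "cmod (of_real d * ?v) \<le> 8 * r"
      using that norm_triangle_ineq4[of "e - of_real d * (?\<gamma>1 * of_nat p' + ?\<gamma>2 * of_nat q')"
        "e - of_real d * (?\<gamma>1 * of_nat p + ?\<gamma>2 * of_nat q)"] by simp
    then have "d * cmod ?v \<le> 8 * r" using d0 by (simp only: norm_mult norm_of_real abs_of_pos)
    then have "d * cmod ?v * (cmod ?\<gamma>1 + cmod ?\<gamma>2) \<le> 8 * r * (cmod ?\<gamma>1 + cmod ?\<gamma>2)"
      by (intro mult_right_mono) auto
    with sp have "d * (cmod ?v * (cmod ?\<gamma>1 + cmod ?\<gamma>2)) < d * \<bar>Im (?\<gamma>2 * cnj ?\<gamma>1)\<bar>"
      by (simp only: mult.assoc)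
    with d0 have "cmod ?v * (cmod ?\<gamma>1 + cmod ?\<gamma>2) < \<bar>Im (?\<gamma>2 * cnj ?\<gamma>1)\<bar>"
      by (simp only: mult_less_cancel_left_pos)
    from integer_combination_separated[OF this] show ?thesis by simp
  qed
  have "s 0 = s' 0 \<and> s 2 = s' 2" "s 1 = s' 1 \<and> s 3 = s' 3"
    using eq[OF conjunct1 conjunct1] eq[OF conjunct2 conjunct2]
      s[unfolded consistent_def Let_def] s'[unfolded consistent_def Let_def] by blast+
  moreover have "i = 0 \<or> i = 1 \<or> i = 2 \<or> i = 3" using i by linarith
  ultimately show ?thesis by auto
qed

lemma measurable_consistent:
  assumes [measurable]: "\<And>t. t < 3 \<Longrightarrow> (\<lambda>x. f x t) \<in> borel_measurable M"
  shows "Measurable.pred M (\<lambda>x. consistent H d r l j (f x) s)"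
proof -
  have [measurable]: "(\<lambda>x. f x 0) \<in> borel_measurable M" "(\<lambda>x. f x 1) \<in> borel_measurable M"
    "(\<lambda>x. f x 2) \<in> borel_measurable M" "(\<lambda>x. f x (Suc 0)) \<in> borel_measurable M"
    by (rule assms; simp)+
  have "(\<lambda>x. fst (block_estimate F c (f x))) \<in> borel_measurable M"
    "(\<lambda>x. snd (block_estimate F c (f x))) \<in> borel_measurable M" for F c
    by (cases F; simp add: block_estimate_def Let_def)+
  note [measurable] = this
  show ?thesis unfolding consistent_def Let_def by measurable
qed

text \<open>\<open>K\<close> depends on the states alone, so for a fixed spacing the power
  constraint allows \<open>Q\<close> to grow like the square root of \<open>P\<close>.\<close>

lemma norm_block_input_le:
  obtains K where "0 < K"
    and "\<And>d \<sigma> Q t. 0 \<le> d \<Longrightarrow> (\<And>l i. i < 4 \<Longrightarrow> \<sigma> l i \<le> Q) \<Longrightarrow> norm (block_input H d \<sigma> t) \<le> K * d * real Q"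
proof -
  define K where "K = 1 + (\<Sum>i\<in>UNIV. \<Sum>l\<in>UNIV. 2 * cmod (beam1 (H $ other l) $ i) + 2 * cmod (beam2 (H $ other l) $ i))"
  have "norm (block_input H d \<sigma> t) \<le> K * d * real Q"
    if d: "0 \<le> d" and Q: "\<And>l i. i < 4 \<Longrightarrow> \<sigma> l i \<le> Q" for d \<sigma> Q t
  proof -
    have s: "cmod (block_signal F t (of_real (d * \<sigma> l i)) (of_real (d * \<sigma> l k))) \<le> 2 * (d * Q)"
      if "i < 4" "k < 4" for F l i k
    proof -
      have dQ: "cmod (of_real (d * \<sigma> l i)) \<le> d * Q" if "i < 4" for i
        using d Q[OF that, of l] by (simp add: norm_mult mult_left_mono)
      have "cmod (block_signal F t x y) \<le> cmod x + cmod y" for x y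
        using norm_triangle_ineq[of x "\<i> * y"] by (simp add: block_signal_def norm_mult)
      from this[of "of_real (d * \<sigma> l i)" "of_real (d * \<sigma> l k)"] dQ[OF that(1)] dQ[OF that(2)]
      show ?thesis by linarith
    qed
    have "norm (block_input H d \<sigma> t) \<le> (\<Sum>i\<in>UNIV. cmod (block_input H d \<sigma> t $ i))"
      unfolding norm_vec_def by (rule L2_set_le_sum) simp
    also have "\<dots> \<le> (\<Sum>i\<in>UNIV. \<Sum>l\<in>UNIV. 2 * (d * Q) * cmod (beam1 (H $ other l) $ i)
        + 2 * (d * Q) * cmod (beam2 (H $ other l) $ i))"
      unfolding block_input_def vec_lambda_beta
      by (intro sum_mono sum_norm_le norm_triangle_mono)
         (auto simp only: norm_mult intro!: mult_right_mono s norm_ge_zero)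
    also have "\<dots> = d * Q * (K - 1)"
      by (simp add: K_def sum_distrib_left algebra_simps)
    also have "\<dots> \<le> K * d * Q" using d by (simp add: algebra_simps)
    finally show ?thesis .
  qed
  moreover have "0 < K" unfolding K_def by (intro add_pos_nonneg sum_nonneg) auto
  ultimately show ?thesis using that by blast
qed

section \<open>Degrees of freedom\<close>

text \<open>A message is accepted if its codeword is consistent outside fewer than \<open>k\<close>
  blocks. With fewer than \<open>k\<close> large noise samples the sent message is accepted, and any
  other accepted codeword would differ from the sent one in fewer than \<open>2 * k\<close> blocks.
  So an error requires at least \<open>k\<close> large samples. Both users share the codebook
  \<open>c\<close>.\<close>

lemma block_code:
  fixes H :: "(2, 3, 2) channel_states" and c :: "nat \<Rightarrow> nat \<Rightarrow> nat \<Rightarrow> nat"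
  assumes d: "well_spaced H r d" and N: "3 * N \<le> n"
    and c: "\<And>i. i < m \<Longrightarrow> c i \<in> (\<Pi>\<^sub>E b\<in>{..<N}. \<Pi>\<^sub>E i\<in>{..<4}. {..<Q})"
    and dist: "\<And>i j. i < m \<Longrightarrow> j < m \<Longrightarrow> i \<noteq> j \<Longrightarrow> 2 * k \<le> card {b \<in> {..<N}. c i b \<noteq> c j b}"
    and m: "\<And>l. nat \<lceil>2 powr (real n * R l)\<rceil> \<le> m"
    and pow: "\<And>\<sigma> t. (\<And>l i. i < 4 \<Longrightarrow> \<sigma> l i \<le> Q) \<Longrightarrow> (norm (block_input H d \<sigma> t))\<^sup>2 \<le> P"
    and P: "0 \<le> P"
  shows "\<exists>enc dec. (\<forall>s l. dec s l \<in> PiM {..<n} (\<lambda>_. borel) \<rightarrow>\<^sub>M count_space UNIV) \<and>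
    average_power n R enc \<le> P \<and>
    (\<forall>s l. error_probability H n R enc dec s l
      \<le> 2 ^ n * measure complex_gaussian {z. r < cmod z} ^ k)"
proof -
  have mean_le: "sum f A / real (card A) \<le> x" if "\<And>w. w \<in> A \<Longrightarrow> f w \<le> x" "0 \<le> x"
    for f :: "'b \<Rightarrow> real" and A x
    using sum_bounded_above[of A f x] that
    by (cases "card A = 0") (auto simp: divide_le_eq mult.commute)
  define \<B> where "\<B> = {B \<in> Pow {..<N}. card B < k}"
  have fin\<B>: "finite \<B>" by (simp add: \<B>_def)
  \<comment> \<open>The channel uses beyond the last complete block carry zero.\<close>
  define enc where "enc w t = (if t < 3 * N then block_input H d (\<lambda>l. c (w l) (t div 3)) (t mod 3) else 0)"
    for w :: "2 \<Rightarrow> nat" and t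
  \<comment> \<open>Quantifying over the finite family of exceptional sets makes measurability a
    matter of finite unions and intersections.\<close>
  define fits where "fits s l y v \<longleftrightarrow> v < m \<and>
    (\<exists>B\<in>\<B>. \<forall>b\<in>{..<N} - B. consistent H d r l (s l) (\<lambda>t. y (3 * b + t)) (c v b))"
    for s :: "2 \<Rightarrow> 3" and l y v
  define dec where "dec s l y = (LEAST v. fits s l y v)" for s l y
  have w_lt: "w l < m" if "w \<in> messages n R" for w l
  proof -
    have "w l < nat \<lceil>2 powr (real n * R l)\<rceil>"
      using that PiE_mem[of w UNIV _ l] by (auto simp: messages_def)
    then show ?thesis using m[of l] by linarith
  qed
  have meas: "dec s l \<in> PiM {..<n} (\<lambda>_. borel) \<rightarrow>\<^sub>M count_space UNIV" for s l
  proof -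
    have "Measurable.pred (PiM {..<n} (\<lambda>_. borel)) (\<lambda>y. consistent H d r l (s l) (\<lambda>t. y (3 * b + t)) (c v b))"
      if "b < N" for b v
      using that N by (intro measurable_consistent measurable_component_singleton) auto
    then have "Measurable.pred (PiM {..<n} (\<lambda>_. borel)) (\<lambda>y. fits s l y v)" for v
      unfolding fits_def using fin\<B> by (intro pred_intros_logic pred_intros_finite) auto
    then show ?thesis unfolding dec_def by (rule measurable_Least)
  qed
  have "average_power n R enc \<le> P"
    unfolding average_power_def
  proof (rule mean_le[OF _ P])
    fix w assume w: "w \<in> messages n R"
    have "(norm (enc w t))\<^sup>2 \<le> P" for t
    proof (cases "t < 3 * N")
      case True
      then have "t div 3 < N" by auto
      have "c (w l) (t div 3) i \<le> Q" if "i < 4" for l i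
        using PiE_mem[OF PiE_mem[OF c[OF w_lt[OF w]]], of "t div 3" i] \<open>t div 3 < N\<close> that
        by (simp add: less_imp_le)
      then show ?thesis using pow True by (simp add: enc_def)
    next
      case False
      then show ?thesis using P by (simp add: enc_def)
    qed
    then have "(\<Sum>t<n. (norm (enc w t))\<^sup>2) \<le> n * P"
      using sum_bounded_above[of "{..<n}" "\<lambda>t. (norm (enc w t))\<^sup>2" P] by simp
    then show "(\<Sum>t<n. (norm (enc w t))\<^sup>2) / real n \<le> P"
      using P by (cases "n = 0") (simp_all add: divide_le_eq mult.commute)
  qed
  moreover have "error_probability H n R enc dec s l \<le> 2 ^ n * measure complex_gaussian {z. r < cmod z} ^ k" for s l
    unfolding error_probability_def
  proof (rule mean_le)
    fix w assume w: "w \<in> messages n R"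
    have correct: "dec s l (received n (H $ l $ s l) (enc w) z) = w l"
      if few: "card {t \<in> {..<n}. r < cmod (z t)} < k" for z
    proof -
      let ?y = "received n (H $ l $ s l) (enc w) z"
      define B0 where "B0 = {b \<in> {..<N}. \<exists>t<3. r < cmod (z (3 * b + t))}"
      \<comment> \<open>Each spoiled block contains a large sample, so there are no more spoiled
        blocks than large samples.\<close>
      have "B0 \<subseteq> (\<lambda>t. t div 3) ` {t \<in> {..<n}. r < cmod (z t)}"
      proof
        fix b assume "b \<in> B0"
        then obtain t where t: "b < N" "t < 3" "r < cmod (z (3 * b + t))" by (auto simp: B0_def)
        then have "3 * b + t < n" "b = (3 * b + t) div 3" using N by auto
        with t show "b \<in> (\<lambda>t. t div 3) ` {t \<in> {..<n}. r < cmod (z t)}" by blast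
      qed
      then have "card B0 \<le> card {t \<in> {..<n}. r < cmod (z t)}"
        by (intro surj_card_le) auto
      with few have B0: "B0 \<in> \<B>" by (auto simp: \<B>_def B0_def)
      have "consistent H d r l (s l) (\<lambda>t. ?y (3 * b + t)) ((\<lambda>l. c (w l) b) l)" if "b \<in> {..<N} - B0" for b
      proof (rule consistent_transmitted[where z = "\<lambda>t. z (3 * b + t)"])
        fix t :: nat assume t: "t < 3"
        with that have "3 * b + t < 3 * N" by auto
        moreover have "(3 * b + t) div 3 = b" "(3 * b + t) mod 3 = t" using t by auto
        ultimately show "?y (3 * b + t) = (\<Sum>i\<in>UNIV. H $ l $ s l $ i * block_input H d (\<lambda>l. c (w l) b) t $ i) + z (3 * b + t)"
          using N by (simp add: received_def enc_def)
        have "\<not> r < cmod (z (3 * b + t))" using that t unfolding B0_def by blast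
        then show "cmod (z (3 * b + t)) \<le> r" by simp
      qed
      then have fit: "fits s l ?y (w l)" using B0 w_lt[OF w] by (auto simp: fits_def)
      have unique: "v = w l" if "fits s l ?y v" for v
      proof (rule ccontr)
        assume ne: "v \<noteq> w l"
        from that fit obtain B B' where B: "B \<in> \<B>" "B' \<in> \<B>" and v: "v < m"
          and cons: "\<And>b. b \<in> {..<N} - B \<Longrightarrow> consistent H d r l (s l) (\<lambda>t. ?y (3 * b + t)) (c v b)"
            "\<And>b. b \<in> {..<N} - B' \<Longrightarrow> consistent H d r l (s l) (\<lambda>t. ?y (3 * b + t)) (c (w l) b)"
          unfolding fits_def by blast
        \<comment> \<open>Outside both exceptional sets the two symbol tuples are consistent with
          the same block, hence equal.\<close>
        have "{b \<in> {..<N}. c v b \<noteq> c (w l) b} \<subseteq> B \<union> B'"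
        proof (rule subsetI, rule ccontr)
          fix b assume b: "b \<in> {b \<in> {..<N}. c v b \<noteq> c (w l) b}" and nb: "b \<notin> B \<union> B'"
          have "c v b = c (w l) b"
          proof (rule PiE_ext)
            show "c v b \<in> (\<Pi>\<^sub>E i\<in>{..<4}. {..<Q})" "c (w l) b \<in> (\<Pi>\<^sub>E i\<in>{..<4}. {..<Q})"
              using PiE_mem[OF c[OF v], of b] PiE_mem[OF c[OF w_lt[OF w]], of b] b by auto
            fix i :: nat assume "i \<in> {..<4}"
            then show "c v b i = c (w l) b i"
              using consistent_unique[OF d cons(1) cons(2)] b nb by simp
          qed
          with b show False by simp
        qed
        then have "card {b \<in> {..<N}. c v b \<noteq> c (w l) b} \<le> card (B \<union> B')"
          using B by (intro card_mono) (auto simp: \<B>_def intro: finite_subset)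
        also have "\<dots> \<le> card B + card B'" by (rule card_Un_le)
        also have "\<dots> < 2 * k" using B by (simp add: \<B>_def)
        finally show False using dist[OF v w_lt[OF w] ne] by simp
      qed
      show ?thesis
        unfolding dec_def by (rule Least_equality, rule fit, drule unique, simp)
    qed
    show "measure (noise n) {z \<in> space (noise n). dec s l (received n (H $ l $ s l) (enc w) z) \<noteq> w l}
      \<le> 2 ^ n * measure complex_gaussian {z. r < cmod z} ^ k"
      using correct by (intro measure_noise_many_large_le) (auto simp: not_less[symmetric])
  qed simp
  ultimately show ?thesis using meas by blast
qed

text \<open>The size condition of \<open>gilbert_varshamov\<close> for words of
  \<open>n div 3\<close> blocks over \<open>Q ^ 4\<close> symbol tuples, at distance
  \<open>2 * (n div M + 1)\<close>. The distance costs \<open>8 / M\<close> in the coefficient of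
  \<open>log 2 Q\<close>. Of the loss \<open>4 / 3\<close>, one third pays for
  \<open>2 ^ (n div 3)\<close>, and 1 absorbs all rounding, \<open>1 + 12 * log 2 Q \<le> n\<close>
  in total.\<close>

lemma code_size_bound:
  fixes M n Q :: nat and \<rho> :: real
  assumes M: "0 < M" and Q: "1 \<le> Q" and \<rho>0: "0 \<le> \<rho>"
    and \<rho>: "\<rho> \<le> (4 / 3 - 8 / M) * log 2 Q - 4 / 3" and n: "1 + 12 * log 2 Q \<le> n"
  shows "nat \<lceil>2 powr (real n * \<rho>)\<rceil> * (2 ^ (n div 3) * (Q ^ 4) ^ (2 * (n div M + 1))) \<le> (Q ^ 4) ^ (n div 3)"
proof -
  define lg where "lg = log 2 Q"
  have lg: "0 \<le> lg" using Q by (simp add: lg_def)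
  have Qp: "real Q = 2 powr lg" using Q by (simp add: lg_def)
  have "1 \<le> 2 powr (real n * \<rho>)" using \<rho>0 by (intro ge_one_powr_ge_zero) auto
  then have "real (nat \<lceil>2 powr (real n * \<rho>)\<rceil>) \<le> 2 * 2 powr (real n * \<rho>)" by linarith
  then have "real (nat \<lceil>2 powr (real n * \<rho>)\<rceil>) \<le> 2 powr (1 + real n * \<rho>)" by (simp add: powr_add)
  moreover have "real (2 ^ (n div 3) * (Q ^ 4) ^ (2 * (n div M + 1))) = 2 powr (real (n div 3) + 8 * (real (n div M) + 1) * lg)"
    by (simp add: Qp powr_add powr_realpow[symmetric] powr_powr flip: power_mult)
       (simp add: powr_add[symmetric] algebra_simps)
  ultimately have "real (nat \<lceil>2 powr (real n * \<rho>)\<rceil>) * real (2 ^ (n div 3) * (Q ^ 4) ^ (2 * (n div M + 1)))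
    \<le> 2 powr (1 + real n * \<rho>) * 2 powr (real (n div 3) + 8 * (real (n div M) + 1) * lg)"
    by (intro mult_mono) auto
  also have "\<dots> = 2 powr ((1 + real n * \<rho>) + (real (n div 3) + 8 * (real (n div M) + 1) * lg))"
    by (simp only: powr_add)
  also have "\<dots> \<le> 2 powr (4 * real (n div 3) * lg)"
  proof -
    have a: "real (n div 3) \<le> n / 3" "n / 3 - 1 \<le> real (n div 3)" by linarith+
    have b: "real (n div M) \<le> n / M" by (rule of_nat_div_le_of_nat)
    have "8 * (real (n div M) + 1) * lg \<le> 8 * (n / M + 1) * lg"
      using b lg by (intro mult_right_mono) auto
    moreover have "4 * (n / 3 - 1) * lg \<le> 4 * real (n div 3) * lg"
      using a lg by (intro mult_right_mono) auto
    moreover have "real n * \<rho> \<le> real n * ((4 / 3 - 8 / M) * lg - 4 / 3)"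
      using \<rho> by (intro mult_left_mono) (auto simp: lg_def)
    moreover have "1 + real n * ((4 / 3 - 8 / M) * lg - 4 / 3) + n / 3 + 8 * (n / M + 1) * lg \<le> 4 * (n / 3 - 1) * lg"
      using n by (simp add: lg_def algebra_simps)
    ultimately show ?thesis using a by (intro powr_mono) auto
  qed
  also have "\<dots> = real ((Q ^ 4) ^ (n div 3))"
    by (simp add: Qp powr_realpow[symmetric] powr_powr flip: power_mult)
       (simp add: algebra_simps)
  finally show ?thesis by (simp only: of_nat_mult[symmetric] of_nat_le_iff)
qed

text \<open>Each user sends four symbols of about half of \<open>log 2 P\<close> bits in three
  channel uses, which is two thirds of \<open>log 2 P\<close> per use. \<open>M\<close> sets the
  fraction of samples that may be large; \<open>6 < M\<close> keeps the coefficient positive. The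
  tail bound \<open>1 / 4 ^ M\<close> beats the factor \<open>2 ^ n\<close> of the union
  bound.\<close>

lemma achievable_rate:
  assumes gen: "generic_states H" and M: "6 < M"
  shows "\<exists>C. \<forall>\<^sub>F P in at_top. \<exists>R. achievable H P R \<and> (4 / 3 - 8 / real M) * log 2 P - C \<le> (\<Sum>l\<in>UNIV. R l)"
proof -
  obtain r where r: "measure complex_gaussian {z. r < cmod z} \<le> 1 / 4 ^ M"
    by (rule complex_gaussian_tail[of "1 / 4 ^ M"]) simp
  obtain d where d: "well_spaced H r d" by (rule ex_well_spaced[OF gen])
  then have d0: "0 < d" by (simp add: well_spaced_def)
  obtain K where K: "0 < K" and norm_le:
    "\<And>d \<sigma> Q t. 0 \<le> d \<Longrightarrow> (\<And>l i. i < 4 \<Longrightarrow> \<sigma> l i \<le> Q) \<Longrightarrow> norm (block_input H d \<sigma> t) \<le> K * d * real Q"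
    by (rule norm_block_input_le[of H]) blast
  define a where "a = 4 / 3 - 8 / real M"
  have a: "0 < a" using M by (simp add: a_def field_simps)
  \<comment> \<open>Collects, for both users, the factor 2 lost in rounding \<open>Q\<close>, the
    factor \<open>K * d\<close> of the power constraint and the loss of
    \<open>code_size_bound\<close>.\<close>
  define C where "C = 2 * (a * log 2 (2 * (K * d)) + 4 / 3)"
  have Kd: "0 < K * d" using K d0 by simp
  have rate: "\<exists>R. achievable H P R \<and> a * log 2 P - C \<le> (\<Sum>l\<in>UNIV. R l)"
    if P1: "(2 * (K * d))\<^sup>2 \<le> P" and P2: "C / a \<le> log 2 P" and P3: "0 < P" for P
  proof -
    \<comment> \<open>The largest grid that the power allows. \<open>P1\<close> makes the quotient
      at least 2, so rounding down loses at most a factor 2.\<close>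
    define Q where "Q = nat \<lfloor>sqrt P / (K * d)\<rfloor>"
    have "2 * (K * d) \<le> sqrt P" using P1 by (rule real_le_rsqrt)
    then have sq: "2 \<le> sqrt P / (K * d)" using Kd by (simp add: pos_le_divide_eq)
    have Q: "real Q \<le> sqrt P / (K * d)" "sqrt P / (K * d) / 2 \<le> real Q" "1 \<le> Q"
    proof -
      have "real (nat \<lfloor>x\<rfloor>) \<le> x \<and> x / 2 \<le> real (nat \<lfloor>x\<rfloor>)" if "2 \<le> x" for x :: real
      proof -
        have "real (nat \<lfloor>x\<rfloor>) = of_int \<lfloor>x\<rfloor>" using that by simp
        then show ?thesis using that by linarith
      qed
      from this[OF sq] show "real Q \<le> sqrt P / (K * d)" and half: "sqrt P / (K * d) / 2 \<le> real Q"
        unfolding Q_def by blast+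
      have "2 / 2 \<le> sqrt P / (K * d) / 2" using sq by (rule divide_right_mono) simp
      then have "2 / 2 \<le> real Q" using half by (rule order_trans)
      then show "1 \<le> Q" by simp
    qed
    define \<rho> where "\<rho> = a * log 2 P / 2 - C / 2"
    have \<rho>0: "0 \<le> \<rho>" using P2 a by (simp add: \<rho>_def field_simps)
    have "log 2 P / 2 - log 2 (2 * (K * d)) = log 2 (sqrt P / (2 * (K * d)))"
      using P3 Kd by (subst log_divide) (auto simp: powr_half_sqrt[symmetric] log_powr)
    also have "\<dots> \<le> log 2 Q"
      using Q P3 Kd by (subst log_le_cancel_iff) (auto simp: field_simps)
    finally have "a * (log 2 P / 2 - log 2 (2 * (K * d))) \<le> a * log 2 Q"
      using a by (intro mult_left_mono) auto
    moreover have "C / 2 = a * log 2 (2 * (K * d)) + 4 / 3" by (simp add: C_def)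
    ultimately have \<rho>: "\<rho> \<le> a * log 2 Q - 4 / 3"
      unfolding \<rho>_def right_diff_distrib times_divide_eq_right by linarith
    let ?R = "\<lambda>_::2. \<rho>"
    have pow: "(norm (block_input H d \<sigma> t))\<^sup>2 \<le> P" if "\<And>l i. i < 4 \<Longrightarrow> \<sigma> l i \<le> Q" for \<sigma> t
    proof -
      have "norm (block_input H d \<sigma> t) \<le> K * d * real Q" using norm_le that d0 by simp
      also have "\<dots> \<le> sqrt P" using Q(1) Kd by (simp add: pos_le_divide_eq mult.commute)
      finally have "(norm (block_input H d \<sigma> t))\<^sup>2 \<le> (sqrt P)\<^sup>2" by (intro power_mono) auto
      then show ?thesis using P3 by simp
    qed
    have code: "\<exists>enc dec. (\<forall>s l. dec s l \<in> PiM {..<n} (\<lambda>_. borel) \<rightarrow>\<^sub>M count_space UNIV) \<and>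
      average_power n ?R enc \<le> P \<and> (\<forall>s l. error_probability H n ?R enc dec s l \<le> (1 / 2) ^ n)"
      if n: "1 + 12 * log 2 Q \<le> n" for n
    proof -
      let ?S = "\<Pi>\<^sub>E i\<in>{..<4::nat}. {..<Q}" and ?k = "n div M + 1"
      have S: "finite ?S" "?S \<noteq> {}" "card ?S = Q ^ 4"
        using Q(3) by (auto intro!: finite_PiE simp: card_PiE PiE_eq_empty_iff lessThan_empty_iff)
      have size: "nat \<lceil>2 powr (real n * \<rho>)\<rceil> * (2 ^ (n div 3) * card ?S ^ (2 * ?k)) \<le> card ?S ^ (n div 3)"
        unfolding S(3) using M Q(3) \<rho>0 \<rho> n by (intro code_size_bound) (auto simp: a_def)
      obtain c where c: "\<And>i. i < nat \<lceil>2 powr (real n * \<rho>)\<rceil> \<Longrightarrow> c i \<in> (\<Pi>\<^sub>E b\<in>{..<n div 3}. ?S)"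
        "\<And>i j. i < nat \<lceil>2 powr (real n * \<rho>)\<rceil> \<Longrightarrow> j < nat \<lceil>2 powr (real n * \<rho>)\<rceil> \<Longrightarrow> i \<noteq> j \<Longrightarrow>
          2 * ?k \<le> card {b \<in> {..<n div 3}. c i b \<noteq> c j b}"
        by (rule gilbert_varshamov[OF S(1,2) size]) blast
      have "2 ^ n * measure complex_gaussian {z. r < cmod z} ^ ?k \<le> 2 ^ n * (1 / 4 ^ M) ^ ?k"
        using r by (intro mult_left_mono power_mono) auto
      also have "\<dots> = 2 ^ n * (1 / 4) ^ (M * ?k)"
        by (simp only: power_mult power_one_over)
      also have "\<dots> \<le> 2 ^ n * (1 / 4) ^ n"
      proof -
        \<comment> \<open>The summand 1 in \<open>?k\<close> makes up for the rounding in
          \<open>n div M\<close>.\<close>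
        have "n \<le> M * ?k" using M dividend_less_times_div[of M n] by simp
        then show ?thesis by (intro mult_left_mono power_decreasing) auto
      qed
      also have "\<dots> = (1 / 2 :: real) ^ n" by (simp only: power_mult_distrib[symmetric]) simp
      finally have small: "2 ^ n * measure complex_gaussian {z. r < cmod z} ^ ?k \<le> (1 / 2) ^ n" .
      have "\<exists>enc dec. (\<forall>s l. dec s l \<in> PiM {..<n} (\<lambda>_. borel) \<rightarrow>\<^sub>M count_space UNIV) \<and>
        average_power n ?R enc \<le> P \<and> (\<forall>s l. error_probability H n ?R enc dec s l
          \<le> 2 ^ n * measure complex_gaussian {z. r < cmod z} ^ ?k)"
        by (rule block_code[OF d _ c order_refl pow less_imp_le[OF P3]]) simp
      then show ?thesis by (elim ex_forward conj_forward all_forward order_trans[OF _ small])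
    qed
    have "achievable H P ?R"
      unfolding achievable_def
    proof (intro conjI allI impI \<rho>0)
      fix \<epsilon> :: real assume \<epsilon>: "0 < \<epsilon>"
      have "(\<lambda>n. (1 / 2 :: real) ^ n) \<longlonglongrightarrow> 0" by (rule LIMSEQ_power_zero) simp
      from order_tendstoD(2)[OF this \<epsilon>]
      have "\<forall>\<^sub>F n in sequentially. (1 / 2 :: real) ^ n \<le> \<epsilon>" by eventually_elim simp
      moreover have "\<forall>\<^sub>F n in sequentially. 1 + 12 * log 2 Q \<le> real n"
        using filterlim_real_sequentially by (simp add: filterlim_at_top)
      ultimately show "\<forall>\<^sub>F n in sequentially. \<exists>enc dec.
        (\<forall>s l. dec s l \<in> PiM {..<n} (\<lambda>_. borel) \<rightarrow>\<^sub>M count_space UNIV) \<and>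
        average_power n ?R enc \<le> P \<and> (\<forall>s l. error_probability H n ?R enc dec s l \<le> \<epsilon>)"
      proof eventually_elim
        case (elim n)
        from code[OF elim(2)] show ?case
          by (elim ex_forward conj_forward all_forward order_trans[OF _ elim(1)])
      qed
    qed
    moreover have "a * log 2 P - C \<le> (\<Sum>l\<in>UNIV. ?R l)" by (simp add: \<rho>_def)
    ultimately show ?thesis by blast
  qed
  have large: "\<forall>\<^sub>F P in at_top. C / a \<le> log 2 P"
  proof -
    have "\<forall>\<^sub>F P in at_top. 2 powr (C / a) \<le> P \<and> 0 < P"
      by (intro eventually_conj eventually_ge_at_top eventually_gt_at_top)
    then show ?thesis by eventually_elim (simp add: le_log_iff)
  qed
  have "\<forall>\<^sub>F P in at_top. \<exists>R. achievable H P R \<and> a * log 2 P - C \<le> (\<Sum>l\<in>UNIV. R l)"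
    using eventually_ge_at_top[of "(2 * (K * d))\<^sup>2"] large eventually_gt_at_top[of "0 :: real"]
    by eventually_elim (rule rate)
  then show ?thesis unfolding a_def by blast
qed

text \<open>States 1 and 3 of either user form a basis, so Cramer's rule expresses state 1 of the
  other user through them. The two resulting tradeoffs add up to three times the sum rate.\<close>

lemma sum_rate_upper_bound:
  assumes gen: "generic_states H"
  shows "\<exists>C. \<forall>P\<ge>4. \<forall>R. achievable H P R \<longrightarrow> (\<Sum>l\<in>UNIV. R l) \<le> 4 / 3 * log 2 P + C"
proof -
  have ex: "\<exists>C. \<forall>P\<ge>4. \<forall>R. achievable H P R \<longrightarrow> 2 * R k + R (other k) \<le> 2 * log 2 P + C" for k
  proof -
    let ?h1 = "H $ k $ 1" and ?h3 = "H $ k $ 3" and ?g = "H $ other k $ 1"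
    have D: "det2 ?h3 ?h1 \<noteq> 0"
    proof
      assume "det2 ?h3 ?h1 = 0"
      moreover have "Im (det2 ?h3 (H $ k $ 2) * det2 ?g ?h1 * cnj (det2 ?h3 ?h1 * det2 ?g (H $ k $ 2))) \<noteq> 0"
        using gen other(1)[of k] unfolding generic_states_def by metis
      ultimately show False by simp
    qed
    have "?g $ i = det2 ?h3 ?g / det2 ?h3 ?h1 * ?h1 $ i + det2 ?g ?h1 / det2 ?h3 ?h1 * ?h3 $ i" for i
    proof -
      have "det2 ?h3 ?h1 * ?g $ i = det2 ?h3 ?g * ?h1 $ i + det2 ?g ?h1 * ?h3 $ i"
        using exhaust_2[of i] by (auto simp: det2_def algebra_simps)
      then show ?thesis using D by (simp add: field_simps)
    qed
    then show ?thesis by (rule rate_tradeoff[OF other(2) other(1)[symmetric]])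
  qed
  obtain C1 where C1: "\<forall>P\<ge>4. \<forall>R. achievable H P R \<longrightarrow> 2 * R 1 + R 2 \<le> 2 * log 2 P + C1"
    using ex[of 1] by (auto simp: other_def)
  obtain C2 where C2: "\<forall>P\<ge>4. \<forall>R. achievable H P R \<longrightarrow> 2 * R 2 + R 1 \<le> 2 * log 2 P + C2"
    using ex[of 2] by (auto simp: other_def)
  have "(\<Sum>l\<in>UNIV. R l) \<le> 4 / 3 * log 2 P + (C1 / 3 + C2 / 3)" if "4 \<le> P" "achievable H P R" for P R
    using C1[rule_format, OF that] C2[rule_format, OF that] unfolding sum_2 by linarith
  then show ?thesis by blast
qed

section \<open>Convergence of the normalized sum capacity\<close>

lemma has_dof_generic:
  assumes gen: "generic_states H"
  shows "has_dof H (4 / 3)"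
  unfolding has_dof_def
proof (rule order_tendstoI)
  have log_large: "\<forall>\<^sub>F P in at_top. x < log 2 P" for x :: real
  proof -
    have "\<forall>\<^sub>F P in at_top. 2 powr x < P \<and> 0 < P"
      by (intro eventually_conj eventually_gt_at_top)
    then show ?thesis by eventually_elim (simp add: less_log_iff)
  qed
  fix y :: ereal
  {
    assume "y < ereal (4 / 3)"
    then obtain x where x: "y < ereal x" "x < 4 / 3" using ereal_dense2[of y "4 / 3"] by auto
    \<comment> \<open>Half of the gap \<open>4 / 3 - x\<close> covers the loss \<open>8 / M\<close>,
      the other half absorbs the constant \<open>C\<close> for large \<open>P\<close>.\<close>
    obtain M0 :: nat where M0: "16 / (4 / 3 - x) < real M0" using reals_Archimedean2 by blast
    define M where "M = M0 + 7"
    have M: "6 < M" by (simp add: M_def)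
    have "16 / (4 / 3 - x) < real M" using M0 by (simp add: M_def)
    then have Mx: "x < 4 / 3 - 8 / M - (4 / 3 - x) / 2" using x M by (simp add: field_simps)
    obtain C where C: "\<forall>\<^sub>F P in at_top. \<exists>R. achievable H P R \<and> (4 / 3 - 8 / real M) * log 2 P - C \<le> (\<Sum>l\<in>UNIV. R l)"
      using achievable_rate[OF gen M] by blast
    show "\<forall>\<^sub>F P in at_top. y < sum_capacity H P / ereal (log 2 P)"
      using C log_large[of 0] log_large[of "C / ((4 / 3 - x) / 2)"]
    proof eventually_elim
      case (elim P)
      then obtain R where R: "achievable H P R" "(4 / 3 - 8 / real M) * log 2 P - C \<le> (\<Sum>l\<in>UNIV. R l)" by blast
      have "C < (4 / 3 - x) / 2 * log 2 P" using elim(3) x by (simp add: pos_divide_less_eq mult.commute)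
      moreover have "x * log 2 P < (4 / 3 - 8 / M - (4 / 3 - x) / 2) * log 2 P"
        using Mx elim(2) by (rule mult_strict_right_mono)
      ultimately have "x * log 2 P \<le> (\<Sum>l\<in>UNIV. R l)"
        using R(2) unfolding left_diff_distrib[of _ "(4 / 3 - x) / 2"] by linarith
      then have "ereal (x * log 2 P) \<le> sum_capacity H P"
        unfolding sum_capacity_def using R(1) by (intro SUP_upper2[of R]) auto
      then have "ereal (x * log 2 P) / ereal (log 2 P) \<le> sum_capacity H P / ereal (log 2 P)"
        using elim(2) by (intro ereal_divide_right_mono) auto
      also have "ereal (x * log 2 P) / ereal (log 2 P) = ereal x" using elim(2) by simp
      finally show ?case using x(1) by simp
    qed
  next
    assume "ereal (4 / 3) < y"
    then obtain x where x: "ereal x < y" "4 / 3 < x" using ereal_dense2[of "4 / 3" y] by auto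
    obtain C where C: "\<forall>P\<ge>4. \<forall>R. achievable H P R \<longrightarrow> (\<Sum>l\<in>UNIV. R l) \<le> 4 / 3 * log 2 P + C"
      using sum_rate_upper_bound[OF gen] by blast
    show "\<forall>\<^sub>F P in at_top. sum_capacity H P / ereal (log 2 P) < y"
      using log_large[of 0] log_large[of "C / (x - 4 / 3)"] eventually_ge_at_top[of 4]
    proof eventually_elim
      case (elim P)
      have "C < (x - 4 / 3) * log 2 P" using elim(2) x by (simp add: pos_divide_less_eq mult.commute)
      then have "(\<Sum>l\<in>UNIV. R l) \<le> x * log 2 P" if "achievable H P R" for R
        using C[rule_format, OF elim(3) that] by (simp add: algebra_simps)
      then have "sum_capacity H P \<le> ereal (x * log 2 P)"
        unfolding sum_capacity_def by (intro SUP_least) auto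
      then have "sum_capacity H P / ereal (log 2 P) \<le> ereal (x * log 2 P) / ereal (log 2 P)"
        using elim(1) by (intro ereal_divide_right_mono) auto
      also have "ereal (x * log 2 P) / ereal (log 2 P) = ereal x" using elim(1) by simp
      finally show ?case using x(1) by simp
    qed
  }
qed

theorem theorem2:
  fixes \<mu> :: "(2, 3, 2) channel_states measure"
  assumes "prob_space \<mu>"
    and "sets \<mu> = sets borel"
    and "absolutely_continuous lborel \<mu>"
  shows "AE H in \<mu>. has_dof H (4 / 3)"
proof -
  have "AE H in \<mu>. generic_states H"
    using assms AE_generic_states by (intro absolutely_continuous_AE[of \<mu> lborel]) auto
  then show ?thesis by eventually_elim (rule has_dof_generic)
qed

end
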